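(* Let $\mathbb F_q$ be a finite field and $n\ge 1$. Set $d := \left\lceil \frac{3\log n}{\log q}+3\right\rceil$ (so that $n\le q^{(d-3)/3}$). Then one can construct a $4$-term linearly independent set $S\subseteq \mathbb F_q^d$ with $|S|=n$ and $|\mathbb F_q^d|\le q^4\cdot n^3$, in time polynomial in $n+q$. In particular $S$ is a linear Sidon set.
   Context: A subset $S\subseteq \mathbb F^d$ is \emph{$4$-term linearly independent} if every subset $S'\subseteq S$ with $|S'|\le 4$ is linearly independent. A subset $S\subseteq \mathbb F^d$ is a \emph{linear Sidon set} if for all $a,b\in \mathbb F\setminus\{0\}$ and all $x,y,x',y'\in S$ with $x\ne y$ and $x'\ne y'$, the equality $ax+by=ax'+by'$ implies $\{x,y\}=\{x',y'\}$. *)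

theory Defs
  imports
    Complex_Main
    "HOL-Computational_Algebra.Polynomial"
    "Jordan_Normal_Form.Missing_VectorSpace"
begin

text \<open>Coordinates are indexed by \<open>0, ..., d - 1\<close>.\<close>

abbreviation coord_space ::
  "('a, 'r) ring_scheme \<Rightarrow> nat \<Rightarrow> ('a, nat \<Rightarrow> 'a) module" where
  "coord_space F d \<equiv> LinearCombinations.ring.func_space F {..<d}"

definition four_term_independent ::
  "('a, 'r) ring_scheme \<Rightarrow> ('a, 'v, 'm) module_scheme \<Rightarrow> 'v set \<Rightarrow> bool" where
  "four_term_independent F V S \<longleftrightarrow>
     S \<subseteq> carrier V \<and>
     (\<forall>S' \<subseteq> S. finite S' \<and> card S' \<le> 4 \<longrightarrow> \<not> LinearCombinations.module.lin_dep F V S')"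

definition linear_Sidon ::
  "('a, 'r) ring_scheme \<Rightarrow> ('a, 'v, 'm) module_scheme \<Rightarrow> 'v set \<Rightarrow> bool" where
  "linear_Sidon F V S \<longleftrightarrow>
     S \<subseteq> carrier V \<and>
     (\<forall>a \<in> carrier F - {\<zero>\<^bsub>F\<^esub>}. \<forall>b \<in> carrier F - {\<zero>\<^bsub>F\<^esub>}.
      \<forall>x \<in> S. \<forall>y \<in> S. \<forall>x' \<in> S. \<forall>y' \<in> S.
        x \<noteq> y \<and> x' \<noteq> y' \<and>
        (a \<odot>\<^bsub>V\<^esub> x) \<oplus>\<^bsub>V\<^esub> (b \<odot>\<^bsub>V\<^esub> y) = (a \<odot>\<^bsub>V\<^esub> x') \<oplus>\<^bsub>V\<^esub> (b \<odot>\<^bsub>V\<^esub> y') \<longrightarrow>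
        {x, y} = {x', y'})"

text \<open>
  The model of computation is a random access machine over the natural numbers, presented as a
  structured language: a program mentions finitely many registers and finitely many zero-initialised
  arrays. The only arithmetic is addition and truncated subtraction, charged one unit per operation
  (every node of an expression counts). There is no multiplication, so a number computed within
  \<open>t\<close> units has \<open>O(t)\<close> more bits than the largest input; this makes unit-cost time on this
  machine polynomially equivalent to Turing machine time (Cook and Reckhow 1973).
\<close>

record ram_state =
  regs :: "nat \<Rightarrow> nat"
  arrs :: "nat \<Rightarrow> nat \<Rightarrow> nat"

datatype aexp =
    Lit nat
  | Reg nat
  | Load nat aexp
  | Plus aexp aexp
  | Minus aexp aexp

primrec aval :: "aexp \<Rightarrow> ram_state \<Rightarrow> nat" where
  "aval (Lit k) s = k"
| "aval (Reg r) s = regs s r"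
| "aval (Load m a) s = arrs s m (aval a s)"
| "aval (Plus a b) s = aval a s + aval b s"
| "aval (Minus a b) s = aval a s - aval b s"

primrec acost :: "aexp \<Rightarrow> nat" where
  "acost (Lit k) = 1"
| "acost (Reg r) = 1"
| "acost (Load m a) = 1 + acost a"
| "acost (Plus a b) = 1 + acost a + acost b"
| "acost (Minus a b) = 1 + acost a + acost b"

text \<open>The tests of \<open>IfLess a b\<close> and \<open>WhileLess a b\<close> are \<open>a < b\<close>.\<close>

datatype com =
    Skip
  | Assign nat aexp
  | Store nat aexp aexp
  | Seq com com
  | IfLess aexp aexp com com
  | WhileLess aexp aexp com

inductive exec :: "com \<Rightarrow> ram_state \<Rightarrow> nat \<Rightarrow> ram_state \<Rightarrow> bool" where
  Skip: "exec Skip s 1 s"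
| Assign: "exec (Assign r a) s (1 + acost a) (s\<lparr>regs := (regs s)(r := aval a s)\<rparr>)"
| Store: "exec (Store m i a) s (1 + acost i + acost a)
            (s\<lparr>arrs := (arrs s)(m := (arrs s m)(aval i s := aval a s))\<rparr>)"
| Seq: "exec c1 s t1 s' \<Longrightarrow> exec c2 s' t2 s'' \<Longrightarrow> exec (Seq c1 c2) s (t1 + t2) s''"
| IfTrue: "aval a s < aval b s \<Longrightarrow> exec c1 s t s' \<Longrightarrow>
            exec (IfLess a b c1 c2) s (1 + acost a + acost b + t) s'"
| IfFalse: "\<not> aval a s < aval b s \<Longrightarrow> exec c2 s t s' \<Longrightarrow>
            exec (IfLess a b c1 c2) s (1 + acost a + acost b + t) s'"
| WhileFalse: "\<not> aval a s < aval b s \<Longrightarrow>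
            exec (WhileLess a b c) s (1 + acost a + acost b) s"
| WhileTrue: "aval a s < aval b s \<Longrightarrow> exec c s t1 s' \<Longrightarrow> exec (WhileLess a b c) s' t2 s'' \<Longrightarrow>
            exec (WhileLess a b c) s (1 + acost a + acost b + t1 + t2) s''"

inductive_cases SkipE: "exec Skip s t s'"
inductive_cases AssignE: "exec (Assign r a) s t s'"
inductive_cases StoreE: "exec (Store m i a) s t s'"
inductive_cases SeqE: "exec (Seq c1 c2) s t s'"
inductive_cases IfLessE: "exec (IfLess a b c1 c2) s t s'"
inductive_cases WhileLessE: "exec (WhileLess a b c) s t s'"

lemma exec_deterministic:
  "exec c s t s' \<Longrightarrow> exec c s u s'' \<Longrightarrow> t = u \<and> s' = s''"
proof (induction arbitrary: u s'' rule: exec.induct)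
  case (Skip s)
  then show ?case by (rule SkipE) simp
next
  case (Assign r a s)
  then show ?case by (rule AssignE) simp
next
  case (Store m i a s)
  then show ?case by (rule StoreE) simp
next
  case (Seq c1 s t1 s1 c2 t2 s2)
  from Seq.prems show ?case
  proof (rule SeqE)
    fix v1 r v2
    assume u: "u = v1 + v2" and 1: "exec c1 s v1 r" and 2: "exec c2 r v2 s''"
    from Seq.IH(1)[OF 1] have "t1 = v1" "s1 = r" by simp_all
    with Seq.IH(2)[of v2 s''] 2 u show ?thesis by simp
  qed
next
  case (IfTrue a s b c1 t s' c2)
  from IfTrue.prems show ?case
  proof (rule IfLessE)
    fix v
    assume u: "u = Suc (acost a + acost b + v)" and 1: "exec c1 s v s''"
    from IfTrue.IH[OF 1] u show ?thesis by simp
  qed (use IfTrue.hyps in simp)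
next
  case (IfFalse a s b c2 t s' c1)
  from IfFalse.prems show ?case
  proof (rule IfLessE)
    fix v
    assume u: "u = Suc (acost a + acost b + v)" and 1: "exec c2 s v s''"
    from IfFalse.IH[OF 1] u show ?thesis by simp
  qed (use IfFalse.hyps in simp)
next
  case (WhileFalse a s b c)
  from WhileFalse.prems show ?case
    by (rule WhileLessE) (use WhileFalse.hyps in simp_all)
next
  case (WhileTrue a s b c t1 s1 t2 s2)
  from WhileTrue.prems show ?case
  proof (rule WhileLessE)
    fix v1 r v2
    assume u: "u = Suc (acost a + acost b + v1 + v2)"
      and 1: "exec c s v1 r" and 2: "exec (WhileLess a b c) r v2 s''"
    from WhileTrue.IH(1)[OF 1] have "t1 = v1" "s1 = r" by simp_all
    with WhileTrue.IH(2)[of v2 s''] 2 u show ?thesis by simp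
  qed (use WhileTrue.hyps in simp)
qed

text \<open>
  The input consists of \<open>n\<close>, of \<open>q = |F|\<close>, and of the field itself, given by its addition and
  multiplication tables with respect to an arbitrary numbering \<open>e\<close> of its elements by
  \<open>0, ..., q - 1\<close>. In particular neither \<open>d\<close> nor the codes of zero and one are supplied.
\<close>

definition input_state ::
  "('a, 'r) ring_scheme \<Rightarrow> (nat \<Rightarrow> 'a) \<Rightarrow> nat \<Rightarrow> ram_state" where
  "input_state F e n =
     (let q = card (carrier F);
          code = inv_into {..<q} e;
          table = (\<lambda>f k. if k < q * q then code (f (e (k div q)) (e (k mod q))) else 0)
      in \<lparr>regs = (\<lambda>_. 0)(0 := n, 1 := q),
          arrs = (\<lambda>_ _. 0)(0 := table (add F), 1 := table (mult F))\<rparr>)"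

text \<open>
  The output is read off array 2, which holds the codes of the coordinates of the \<open>n\<close>
  vectors of length \<open>d\<close>, one vector after the other.
\<close>

definition outputs ::
  "('a, 'r) ring_scheme \<Rightarrow> (nat \<Rightarrow> 'a) \<Rightarrow> nat \<Rightarrow> nat \<Rightarrow> ram_state \<Rightarrow> (nat \<Rightarrow> 'a) set \<Rightarrow> bool" where
  "outputs F e n d s S \<longleftrightarrow>
     (\<forall>i < n * d. arrs s 2 i < card (carrier F)) \<and>
     S = (\<lambda>k. \<lambda>j\<in>{..<d}. e (arrs s 2 (k * d + j))) ` {..<n}"

end

theory Submission
  imports Defs
begin

text \<open>
  The set is built greedily. If \<open>k < n\<close> vectors have been chosen, at most \<open>(q k)\<^sup>3\<close> vectors are of the
  form \<open>a x + b y + c z\<close> with \<open>x\<close>, \<open>y\<close>, \<open>z\<close> among them, and \<open>(q k)\<^sup>3 < (q n)\<^sup>3 \<le> q\<^sup>d\<close>, so there is a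
  vector outside the span of any three chosen ones, and adding it preserves 4-term independence.
  A vector once covered stays covered, so a single pass over the \<open>q\<^sup>d \<le> q\<^sup>4 n\<^sup>3\<close> candidates, each
  tested against all combinations by brute force, finds all \<open>n\<close> vectors in polynomial time.
  A coincidence \<open>a x + b y = a x' + b y'\<close> is a linear relation among at most four vectors.
\<close>

section \<open>Running time of programs\<close>

text \<open>The dimension enters only through the equivalence
  \<open>q ^ i < n ^ 3 \<longleftrightarrow> i < d - 3\<close>. At \<open>i = d - 3\<close> it
  leaves room for all combinations; at \<open>i = d - 4\<close> it keeps \<open>q ^ d\<close> below
  \<open>q ^ 4 * n ^ 3\<close>. The input format shapes the rest. Field elements are known only
  through codes in an arbitrary numbering, and the code of zero is not given, so the program never
  singles out zero. It runs through all coefficients and allows repetitions among \<open>x\<close>,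
  \<open>y\<close>, \<open>z\<close>; zero coefficients then account for combinations of fewer
  vectors. The one exception is the empty list, which has no combinations at all and so misses the
  zero vector. Products and quotients are formed by repeated addition and subtraction, which is
  affordable because all operands are polynomially bounded in \<open>n + q\<close>. The program is
  verified against functions on natural numbers (\<open>greedy\<close>, \<open>covered\<close>);
  their meaning in the vector space is a separate matter.\<close>

definition achieves :: "com \<Rightarrow> nat \<Rightarrow> (ram_state \<Rightarrow> bool) \<Rightarrow> ram_state \<Rightarrow> bool" where
  "achieves c T Q s \<longleftrightarrow> (\<exists>t s'. exec c s t s' \<and> t \<le> T \<and> Q s')"

lemma achieves_mono:
  assumes "achieves c T Q s" and "T \<le> T'" and "\<And>s. Q s \<Longrightarrow> Q' s"
  shows "achieves c T' Q' s"
  using assms unfolding achieves_def by (meson le_trans)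

lemma achieves_le: "achieves c T Q s \<Longrightarrow> T \<le> T' \<Longrightarrow> achieves c T' Q s"
  by (rule achieves_mono)

lemma achieves_Skip: "Q s \<Longrightarrow> achieves Skip 1 Q s"
  unfolding achieves_def by (meson exec.Skip le_refl)

lemma achieves_Assign:
  "Q (s\<lparr>regs := (regs s)(r := aval a s)\<rparr>) \<Longrightarrow> achieves (Assign r a) (1 + acost a) Q s"
  unfolding achieves_def by (intro exI conjI, rule exec.Assign) auto

lemma achieves_Store:
  "Q (s\<lparr>arrs := (arrs s)(m := (arrs s m)(aval i s := aval a s))\<rparr>) \<Longrightarrow>
    achieves (Store m i a) (1 + acost i + acost a) Q s"
  unfolding achieves_def by (intro exI conjI, rule exec.Store) auto

text \<open>The postcondition of \<open>c1\<close> is itself the claim that \<open>c2\<close>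
  succeeds, so the rules apply backwards along a program and budgets simply add up.\<close>

lemma achieves_Seq:
  "achieves c1 T1 (achieves c2 T2 Q) s \<Longrightarrow> achieves (Seq c1 c2) (T1 + T2) Q s"
  unfolding achieves_def by (meson exec.Seq add_le_mono)

text \<open>The budgets of both branches are added instead of maximised, which keeps all time bounds
  polynomial expressions.\<close>

lemma achieves_IfLess:
  assumes "aval a s < aval b s \<Longrightarrow> achieves c1 T1 Q s"
    and "\<not> aval a s < aval b s \<Longrightarrow> achieves c2 T2 Q s"
  shows "achieves (IfLess a b c1 c2) (1 + acost a + acost b + (T1 + T2)) Q s"
proof (cases "aval a s < aval b s")
  case True
  then obtain t s' where "exec c1 s t s'" "t \<le> T1" "Q s'"
    using assms(1) unfolding achieves_def by blast
  then show ?thesis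
    unfolding achieves_def using exec.IfTrue[OF True] by (meson add_le_mono le_refl trans_le_add1)
next
  case False
  then obtain t s' where "exec c2 s t s'" "t \<le> T2" "Q s'"
    using assms(2) unfolding achieves_def by blast
  then show ?thesis
    unfolding achieves_def using exec.IfFalse[OF False] by (meson add_le_mono le_refl trans_le_add2)
qed

text \<open>The invariant is indexed by the number of completed rounds. That a successful test
  forces \<open>i < N\<close> gives termination and the time bound at once, by induction on
  \<open>N - i\<close>.\<close>

lemma achieves_WhileLess:
  assumes init: "J 0 s"
    and step: "\<And>i s. J i s \<Longrightarrow> aval a s < aval b s \<Longrightarrow> i < N \<and> achieves c T (J (Suc i)) s"
    and final: "\<And>i s. J i s \<Longrightarrow> \<not> aval a s < aval b s \<Longrightarrow> Q s"
  shows "achieves (WhileLess a b c)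
           (N * (1 + acost a + acost b + T) + (1 + acost a + acost b)) Q s"
proof -
  let ?w = "WhileLess a b c" and ?C = "1 + acost a + acost b"
  have "achieves ?w (m * (?C + T) + ?C) Q s" if "J i s" "N - i = m" for i m s
    using that
  proof (induction m arbitrary: i s)
    case 0
    then have "\<not> aval a s < aval b s" using step[of i s] by auto
    then show ?case
      unfolding achieves_def using exec.WhileFalse final[OF 0(1)] by force
  next
    case (Suc m)
    show ?case
    proof (cases "aval a s < aval b s")
      case True
      from step[OF Suc.prems(1) True] obtain t1 s1
        where 1: "exec c s t1 s1" "t1 \<le> T" "J (Suc i) s1"
        unfolding achieves_def by blast
      obtain t2 s2 where 2: "exec ?w s1 t2 s2" "t2 \<le> m * (?C + T) + ?C" "Q s2"
        using Suc.IH[OF 1(3)] Suc.prems(2) unfolding achieves_def by (metis Suc_diff_Suc Suc_inject nat.distinct(1) zero_less_Suc zero_less_diff)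
      have "exec ?w s (?C + t1 + t2) s2" using exec.WhileTrue[OF True 1(1) 2(1)] by simp
      moreover have "?C + t1 + t2 \<le> Suc m * (?C + T) + ?C"
        using 1(2) 2(2) by simp
      ultimately show ?thesis unfolding achieves_def using 2(3) by blast
    next
      case False
      then show ?thesis
        unfolding achieves_def using exec.WhileFalse[OF False] final[OF Suc.prems(1) False]
        by (meson le_add2)
    qed
  qed
  from this[OF init refl] show ?thesis by simp
qed

definition For :: "nat \<Rightarrow> nat \<Rightarrow> com \<Rightarrow> com" where
  "For r b c = Seq (Assign r (Lit 0))
     (WhileLess (Reg r) (Reg b) (Seq c (Assign r (Plus (Reg r) (Lit 1)))))"

text \<open>Per round, 3 units go to the test and 4 to the increment; initialisation costs 2 and the
  failing test 3. The invariant for \<open>Suc i\<close> is demanded of the state after the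
  increment, and the body must leave the counter at \<open>i\<close>.\<close>

lemma achieves_For:
  assumes init: "J 0 (s\<lparr>regs := (regs s)(r := 0)\<rparr>)"
    and bound: "\<And>i s. J i s \<Longrightarrow> i \<le> N \<Longrightarrow> regs s r = i \<and> regs s b = N"
    and step: "\<And>i s. J i s \<Longrightarrow> i < N \<Longrightarrow>
      achieves c T (\<lambda>s. regs s r = i \<and> J (Suc i) (s\<lparr>regs := (regs s)(r := Suc i)\<rparr>)) s"
    and final: "\<And>s. J N s \<Longrightarrow> Q s"
  shows "achieves (For r b c) (N * (T + 7) + 5) Q s"
proof -
  have "achieves (For r b c) (2 + (N * (1 + 1 + 1 + (T + 4)) + (1 + 1 + 1))) Q s"
    unfolding For_def
  proof (rule achieves_le, rule achieves_Seq, rule achieves_Assign)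
    show "achieves (WhileLess (Reg r) (Reg b) (Seq c (Assign r (Plus (Reg r) (Lit 1)))))
       (N * (1 + acost (Reg r) + acost (Reg b) + (T + (1 + acost (Plus (Reg r) (Lit 1)))))
          + (1 + acost (Reg r) + acost (Reg b))) Q
       (s\<lparr>regs := (regs s)(r := aval (Lit 0) s)\<rparr>)"
    proof (rule achieves_WhileLess[where J = "\<lambda>i s. i \<le> N \<and> J i s"])
      fix i s
      assume J: "i \<le> N \<and> J i s" and less: "aval (Reg r) s < aval (Reg b) s"
      then have "i < N" using bound by force
      moreover have "achieves (Seq c (Assign r (Plus (Reg r) (Lit 1))))
          (T + (1 + acost (Plus (Reg r) (Lit 1)))) (\<lambda>s. Suc i \<le> N \<and> J (Suc i) s) s"
        by (rule achieves_Seq, rule achieves_mono[OF step], use J \<open>i < N\<close> in simp_all)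
          (rule achieves_le, rule achieves_Assign, simp_all)
      ultimately show "i < N \<and> achieves (Seq c (Assign r (Plus (Reg r) (Lit 1))))
          (T + (1 + acost (Plus (Reg r) (Lit 1)))) (\<lambda>s. Suc i \<le> N \<and> J (Suc i) s) s" ..
    next
      fix i s
      assume J: "i \<le> N \<and> J i s" and "\<not> aval (Reg r) s < aval (Reg b) s"
      then have "i = N" using bound[of i s] by simp
      then show "Q s" using J final by simp
    qed (use init in simp)
  qed (simp add: algebra_simps)
  then show ?thesis by (rule achieves_le) (simp add: algebra_simps)
qed

section \<open>Frame conditions and bounded existential search by a flag\<close>

definition changes :: "nat set \<Rightarrow> nat set \<Rightarrow> ram_state \<Rightarrow> ram_state \<Rightarrow> bool" where
  "changes R A s s' \<longleftrightarrow>
     (\<forall>r. r \<notin> R \<longrightarrow> regs s' r = regs s r) \<and> (\<forall>m. m \<notin> A \<longrightarrow> arrs s' m = arrs s m)"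

text \<open>The shape is chosen so that a loop around such a program is again such a program, for a
  bounded existential. The first conjunct makes \<open>P\<close> and \<open>\<phi>\<close> blind to
  everything that the program modifies; the flag is never lowered, so later rounds cannot undo
  earlier ones.\<close>

definition raises_flag ::
  "com \<Rightarrow> nat \<Rightarrow> nat \<Rightarrow> nat set \<Rightarrow> (ram_state \<Rightarrow> bool) \<Rightarrow> (ram_state \<Rightarrow> bool) \<Rightarrow> bool" where
  "raises_flag c T f R P \<phi> \<longleftrightarrow>
     (\<forall>s s'. changes (insert f R) {} s s' \<longrightarrow> P s' = P s \<and> \<phi> s' = \<phi> s) \<and>
     (\<forall>s. P s \<longrightarrow> achieves c T
        (\<lambda>s'. changes (insert f R) {} s s' \<and> regs s' f = (if \<phi> s then 1 else regs s f)) s)"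

lemma raises_flag_For:
  assumes body: "raises_flag c T f R P \<phi>"
    and r: "r \<notin> insert f R" and b: "b \<notin> insert r (insert f R)"
    and P': "\<And>s. P' s \<Longrightarrow> regs s b \<le> N"
      "\<And>s i. P' s \<Longrightarrow> i < regs s b \<Longrightarrow> P (s\<lparr>regs := (regs s)(r := i)\<rparr>)"
    and ins: "\<And>s s'. changes (insert f (insert r R)) {} s s' \<Longrightarrow> P' s' = P' s"
  shows "raises_flag (For r b c) (N * (T + 7) + 5) f (insert r R) P'
           (\<lambda>s. \<exists>i < regs s b. \<phi> (s\<lparr>regs := (regs s)(r := i)\<rparr>))"
proof -
  let ?set = "\<lambda>s i. s\<lparr>regs := (regs s)(r := i)\<rparr>"
  let ?R = "insert f (insert r R)"
  from body have P\<phi>: "\<And>s s'. changes (insert f R) {} s s' \<Longrightarrow> P s' = P s \<and> \<phi> s' = \<phi> s"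
    and run: "\<And>s. P s \<Longrightarrow> achieves c T
        (\<lambda>s'. changes (insert f R) {} s s' \<and> regs s' f = (if \<phi> s then 1 else regs s f)) s"
    unfolding raises_flag_def by auto
  have upd: "changes (insert f R) {} (?set s i) (?set s' i)" if "changes ?R {} s s'" for s s' i
    using that unfolding changes_def by auto
  have \<phi>: "(\<exists>i < regs s' b. \<phi> (?set s' i)) = (\<exists>i < regs s b. \<phi> (?set s i))"
    if "changes ?R {} s s'" for s s'
  proof -
    have "regs s' b = regs s b" using that b unfolding changes_def by auto
    then show ?thesis using P\<phi>[OF upd[OF that]] by auto
  qed
  have "achieves (For r b c) (N * (T + 7) + 5)
      (\<lambda>s'. changes ?R {} s s' \<and>
         regs s' f = (if \<exists>i < regs s b. \<phi> (?set s i) then 1 else regs s f)) s"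
    if "P' s" for s
  proof (rule achieves_le)
    let ?J = "\<lambda>i s'. changes ?R {} s s' \<and> regs s' r = i \<and>
      regs s' f = (if \<exists>i' < i. \<phi> (?set s i') then 1 else regs s f)"
    show "achieves (For r b c) (regs s b * (T + 7) + 5)
      (\<lambda>s'. changes ?R {} s s' \<and>
         regs s' f = (if \<exists>i < regs s b. \<phi> (?set s i) then 1 else regs s f)) s"
    proof (rule achieves_For[where J = ?J])
      fix i s' assume J: "?J i s'" and i: "i < regs s b"
      \<comment> \<open>Before round \<open>i\<close> the state differs from \<open>?set s i\<close>
        only in registers to which \<open>P\<close> and \<open>\<phi>\<close> are blind, so both can
        be read off the initial state.\<close>
      have s': "?set s' i = s'" using J by auto
      have P1: "P (?set s i)" using P'(2)[OF that i] .
      have ch: "changes (insert f R) {} (?set s i) s'"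
        using upd[of s s' i] J s' by simp
      have Ps: "P s'" and phis: "\<phi> s' = \<phi> (?set s i)"
        using P\<phi>[OF ch] P1 by auto
      show "achieves c T (\<lambda>s'. regs s' r = i \<and> ?J (Suc i) (?set s' (Suc i))) s'"
      proof (rule achieves_mono[OF run[OF Ps] le_refl])
        fix s'' assume s'': "changes (insert f R) {} s' s'' \<and>
          regs s'' f = (if \<phi> s' then 1 else regs s' f)"
        then have "regs s'' r = i" using r J unfolding changes_def by auto
        moreover have "changes ?R {} s (?set s'' (Suc i))"
          using s'' J unfolding changes_def by auto
        moreover have "regs (?set s'' (Suc i)) f =
            (if \<exists>i' < Suc i. \<phi> (?set s i') then 1 else regs s f)"
          using r J s'' phis by (auto simp: less_Suc_eq)
        ultimately show "regs s'' r = i \<and> ?J (Suc i) (?set s'' (Suc i))" by simp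
      qed
    qed (use r b in \<open>auto simp: changes_def\<close>)
    show "regs s b * (T + 7) + 5 \<le> N * (T + 7) + 5"
      using P'(1)[OF that] by simp
  qed
  then show ?thesis
    unfolding raises_flag_def using ins \<phi> by blast
qed

section \<open>The greedy program\<close>

definition digit :: "nat \<Rightarrow> nat \<Rightarrow> nat \<Rightarrow> nat" where
  "digit q i j = i div q ^ j mod q"

text \<open>This is the code of \<open>a u + b v + c w\<close> computed from row-major tables; the
  bracketing is that of \<open>combinations3\<close>.\<close>

definition comb3 :: "nat \<Rightarrow> (nat \<Rightarrow> nat) \<Rightarrow> (nat \<Rightarrow> nat) \<Rightarrow> nat \<Rightarrow> nat \<Rightarrow> nat \<Rightarrow> nat \<Rightarrow> nat \<Rightarrow> nat \<Rightarrow> nat" where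
  "comb3 q T0 T1 a b c u v w =
     T0 (T0 (T1 (a * q + u) * q + T1 (b * q + v)) * q + T1 (c * q + w))"

text \<open>Phrased on codes alone, so that the program can be verified without any algebra;
  \<open>covered_iff\<close> gives the meaning for vectors.\<close>

definition covered ::
  "nat \<Rightarrow> nat \<Rightarrow> (nat \<Rightarrow> nat) \<Rightarrow> (nat \<Rightarrow> nat) \<Rightarrow> nat list \<Rightarrow> nat \<Rightarrow> bool" where
  "covered q d T0 T1 L i \<longleftrightarrow>
     (\<exists>a<q. \<exists>b<q. \<exists>c<q. \<exists>x<length L. \<exists>y<length L. \<exists>z<length L. \<forall>j<d.
        comb3 q T0 T1 a b c (digit q (L ! x) j) (digit q (L ! y) j) (digit q (L ! z) j) = digit q i j)"

text \<open>Candidates start at 1, so that the first vector, which is accepted because the empty list covers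
  nothing, is nonzero.\<close>

fun greedy :: "nat \<Rightarrow> nat \<Rightarrow> (nat \<Rightarrow> nat) \<Rightarrow> (nat \<Rightarrow> nat) \<Rightarrow> nat \<Rightarrow> nat list" where
  "greedy q d T0 T1 0 = []"
| "greedy q d T0 T1 (Suc i) =
     (let L = greedy q d T0 T1 i
      in if covered q d T0 T1 L (Suc i) then L else L @ [Suc i])"

text \<open>Registers: 0 is \<open>n\<close>, 1 is \<open>q\<close>, 2 is \<open>d\<close>, 8 is the number of vectors found so far, 9 is the
  current candidate, 13 is set when the candidate is rejected, 14--16 are the coefficients and 17--19
  the vectors of a combination, 20 is set when it differs from the candidate. Arrays: 3 and 4 hold
  the multiples of \<open>q\<close> and of \<open>d\<close>, which replace multiplication in address computations, and 5 holds
  the digits of the candidate.\<close>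

definition decode :: com where
  "decode = Seq (Assign 10 (Reg 9)) (For 11 2
     (Seq (Assign 12 (Lit 0))
     (Seq (WhileLess (Reg 1) (Plus (Reg 10) (Lit 1))
        (Seq (Assign 10 (Minus (Reg 10) (Reg 1))) (Assign 12 (Plus (Reg 12) (Lit 1)))))
     (Seq (Store 5 (Reg 11) (Reg 10)) (Assign 10 (Reg 12))))))"

text \<open>Each round divides by \<open>q\<close> through repeated subtraction: the remainder stays
  in register 10 and is the next digit, the quotient is counted in register 12. A number up to
  \<open>N\<close> allows at most \<open>N\<close> subtractions, at 13 units each.\<close>

lemma achieves_decode:
  assumes q: "regs s 1 = q" "q > 1" and d: "regs s 2 = d" and x: "regs s 9 = x" "x \<le> N"
  shows "achieves decode (d * (N * 13 + 24) + 7)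
    (\<lambda>s'. changes {10, 11, 12} {5} s s' \<and> (\<forall>j<d. arrs s' 5 j = digit q x j)) s"
proof -
  let ?J = "\<lambda>i s'. changes {10, 11, 12} {5} s s' \<and> regs s' 11 = i \<and> regs s' 10 = x div q ^ i \<and>
    (\<forall>j<i. arrs s' 5 j = digit q x j)"
  let ?body = "Seq (Assign 12 (Lit 0))
     (Seq (WhileLess (Reg 1) (Plus (Reg 10) (Lit 1))
        (Seq (Assign 10 (Minus (Reg 10) (Reg 1))) (Assign 12 (Plus (Reg 12) (Lit 1)))))
     (Seq (Store 5 (Reg 11) (Reg 10)) (Assign 10 (Reg 12))))"
  have body: "achieves ?body (N * 13 + 17)
      (\<lambda>s'. regs s' 11 = i \<and> ?J (Suc i) (s'\<lparr>regs := (regs s')(11 := Suc i)\<rparr>)) s1"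
    if J: "?J i s1" for i s1
  proof -
    let ?y = "x div q ^ i"
    \<comment> \<open>Subtraction is truncated, hence the conjunct \<open>m * q \<le> ?y\<close>.
      The test \<open>q < y + 1\<close> of the loop stands for \<open>q \<le> y\<close>.\<close>
    let ?I = "\<lambda>m s'. changes {10, 12} {} s1 s' \<and> m * q \<le> ?y \<and> regs s' 10 = ?y - m * q \<and> regs s' 12 = m"
    let ?Q = "\<lambda>s'. changes {10, 12} {} s1 s' \<and> regs s' 10 = digit q x i \<and> regs s' 12 = x div q ^ Suc i"
    have "?y \<le> N" using x div_le_dividend le_trans by blast
    have q1: "regs s' 1 = q" if "changes {10, 12} {} s1 s'" for s'
      using that J q unfolding changes_def by simp
    have inner: "achieves (WhileLess (Reg 1) (Plus (Reg 10) (Lit 1))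
        (Seq (Assign 10 (Minus (Reg 10) (Reg 1))) (Assign 12 (Plus (Reg 12) (Lit 1)))))
        (N * 13 + 5) ?Q s2" if s2: "?I 0 s2" for s2
    proof (rule achieves_le, rule achieves_WhileLess[where J = ?I and N = N and T = 8])
      fix m s' assume I: "?I m s'" and less: "aval (Reg 1) s' < aval (Plus (Reg 10) (Lit 1)) s'"
      have le: "Suc m * q \<le> ?y" using less I q1[of s'] by (simp, linarith)
      moreover have "Suc m * 1 \<le> Suc m * q" using q by (intro mult_le_mono2) simp
      ultimately have "Suc m \<le> N" using \<open>?y \<le> N\<close> by (metis le_trans mult.right_neutral)
      then have "m < N" by simp
      moreover have "achieves (Seq (Assign 10 (Minus (Reg 10) (Reg 1))) (Assign 12 (Plus (Reg 12) (Lit 1))))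
          8 (?I (Suc m)) s'"
        by (rule achieves_le, (rule achieves_Seq achieves_Assign)+)
          (use I le q1[of s'] in \<open>auto simp: changes_def\<close>)
      ultimately show "m < N \<and> achieves (Seq (Assign 10 (Minus (Reg 10) (Reg 1))) (Assign 12 (Plus (Reg 12) (Lit 1))))
          8 (?I (Suc m)) s'" ..
    next
      fix m s' assume I: "?I m s'" and nless: "\<not> aval (Reg 1) s' < aval (Plus (Reg 10) (Lit 1)) s'"
      have lt: "?y - m * q < q" using nless I q1[of s'] by simp
      have y: "?y = q * m + (?y - m * q)" using I by (simp add: mult.commute)
      have "?y div q = m" "?y mod q = ?y - m * q"
        using lt y by (metis div_mult_self4 div_less add.right_neutral q(2) not_one_less_zero gr0I)
          (use lt y in \<open>metis mod_mult_self4 mod_less\<close>)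
      moreover have "x div q ^ Suc i = ?y div q" by (simp only: power_Suc2 div_mult2_eq)
      ultimately show "?Q s'" using I by (simp add: digit_def)
    qed (use s2 in auto)
    show ?thesis
      by (rule achieves_le, rule achieves_Seq, rule achieves_Assign, rule achieves_Seq,
          rule achieves_mono[OF inner le_refl], use J in \<open>simp add: changes_def\<close>,
          (rule achieves_Seq achieves_Assign achieves_Store)+)
        (use J in \<open>auto simp: changes_def less_Suc_eq\<close>)
  qed
  show ?thesis unfolding decode_def
  proof (rule achieves_le, rule achieves_Seq, rule achieves_Assign)
    show "achieves (For 11 2 ?body) (d * (N * 13 + 17 + 7) + 5)
      (\<lambda>s'. changes {10, 11, 12} {5} s s' \<and> (\<forall>j<d. arrs s' 5 j = digit q x j))
      (s\<lparr>regs := (regs s)(10 := aval (Reg 9) s)\<rparr>)"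
      by (rule achieves_For[where J = ?J]) (use body d x in \<open>auto simp: changes_def\<close>)
  qed simp
qed

definition comb3_aexp :: aexp where
  "comb3_aexp =
    Load 0 (Plus (Load 3 (Load 0 (Plus
        (Load 3 (Load 1 (Plus (Load 3 (Reg 14)) (Load 2 (Plus (Load 4 (Reg 17)) (Reg 11))))))
        (Load 1 (Plus (Load 3 (Reg 15)) (Load 2 (Plus (Load 4 (Reg 18)) (Reg 11))))))))
      (Load 1 (Plus (Load 3 (Reg 16)) (Load 2 (Plus (Load 4 (Reg 19)) (Reg 11))))))"

section \<open>Brute-force test of a candidate\<close>

definition compare :: com where
  "compare = Seq (Assign 20 (Lit 0)) (Seq
     (For 11 2 (IfLess comb3_aexp (Load 5 (Reg 11)) (Assign 20 (Lit 1))
        (IfLess (Load 5 (Reg 11)) comb3_aexp (Assign 20 (Lit 1)) Skip)))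
     (IfLess (Reg 20) (Lit 1) (Assign 13 (Lit 1)) Skip))"

definition search :: com where
  "search = Seq (Assign 13 (Lit 0))
     (For 14 1 (For 15 1 (For 16 1 (For 17 8 (For 18 8 (For 19 8 compare))))))"

definition prepared ::
  "nat \<Rightarrow> nat \<Rightarrow> nat \<Rightarrow> (nat \<Rightarrow> nat) \<Rightarrow> (nat \<Rightarrow> nat) \<Rightarrow> ram_state \<Rightarrow> bool" where
  "prepared n q d T0 T1 s \<longleftrightarrow>
     regs s 0 = n \<and> regs s 1 = q \<and> regs s 2 = d \<and> arrs s 0 = T0 \<and> arrs s 1 = T1 \<and>
     (\<forall>a<q. arrs s 3 a = a * q) \<and> (\<forall>x<n. arrs s 4 x = x * d)"

definition holds :: "nat \<Rightarrow> nat \<Rightarrow> nat list \<Rightarrow> ram_state \<Rightarrow> bool" where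
  "holds q d L s \<longleftrightarrow> regs s 8 = length L \<and>
     (\<forall>x<length L. \<forall>j<d. arrs s 2 (x * d + j) = digit q (L ! x) j)"

definition searching where
  "searching n q d T0 T1 L i s \<longleftrightarrow> prepared n q d T0 T1 s \<and> holds q d L s \<and> length L \<le> n \<and>
     (\<forall>j<d. arrs s 5 j = digit q i j)"

text \<open>The predicate reads only registers 0, 1, 2, 8 and arrays, so every register from 11 on
  is free as scratch space during the search.\<close>

lemma searching_changes:
  "changes R {} s s' \<Longrightarrow> R \<subseteq> {11..} \<Longrightarrow> searching n q d T0 T1 L i s' = searching n q d T0 T1 L i s"
  unfolding changes_def searching_def prepared_def holds_def
  by (subgoal_tac "\<forall>r\<in>{0,1,2,8}. regs s' r = regs s r") auto

lemma prod_add_less: "x < k \<Longrightarrow> j < d \<Longrightarrow> x * d + j < k * (d::nat)"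
  by (metis Suc_leI add.commute less_le_trans mult_Suc mult_le_mono1 nat_add_left_cancel_less)

text \<open>Intermediate results are used as indices into array 3, which holds multiples of
  \<open>q\<close> only below index \<open>q\<close>; the bounds on the table entries keep them
  there.\<close>

lemma aval_comb3_aexp:
  assumes T: "\<And>x. T0 x < q" "\<And>x. T1 x < q" and s: "searching n q d T0 T1 L i s"
    and r: "regs s 14 < q" "regs s 15 < q" "regs s 16 < q"
      "regs s 17 < length L" "regs s 18 < length L" "regs s 19 < length L" "regs s 11 < d"
  shows "aval comb3_aexp s = comb3 q T0 T1 (regs s 14) (regs s 15) (regs s 16)
     (digit q (L ! regs s 17) (regs s 11)) (digit q (L ! regs s 18) (regs s 11))
     (digit q (L ! regs s 19) (regs s 11))"
proof -
  have "arrs s 0 = T0" "arrs s 1 = T1" and 3: "\<And>a. a < q \<Longrightarrow> arrs s 3 a = a * q"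
    and 4: "\<And>x. x < length L \<Longrightarrow> arrs s 4 x = x * d"
    and 2: "\<And>x j. x < length L \<Longrightarrow> j < d \<Longrightarrow> arrs s 2 (x * d + j) = digit q (L ! x) j"
    using s unfolding searching_def prepared_def holds_def by auto
  then show ?thesis
    unfolding comb3_aexp_def comb3_def using r T by simp
qed

text \<open>Agreement in all coordinates is the negation of an existential: the loop raises flag 20
  at a differing coordinate, and the final test turns a flag still at 0 into flag 13. As the only
  test is \<open><\<close>, inequality takes two nested tests.\<close>

lemma raises_flag_compare:
  assumes T: "\<And>x. T0 x < q" "\<And>x. T1 x < q"
  shows "raises_flag compare (d * 107 + 14) 13 {11, 20}
     (\<lambda>s. searching n q d T0 T1 L i s \<and> regs s 14 < q \<and> regs s 15 < q \<and> regs s 16 < q \<and>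
        regs s 17 < length L \<and> regs s 18 < length L \<and> regs s 19 < length L)
     (\<lambda>s. \<forall>j<d. comb3 q T0 T1 (regs s 14) (regs s 15) (regs s 16) (digit q (L ! regs s 17) j)
        (digit q (L ! regs s 18) j) (digit q (L ! regs s 19) j) = digit q i j)"
    (is "raises_flag _ _ _ _ ?P ?\<phi>")
proof -
  define differs where "differs = IfLess comb3_aexp (Load 5 (Reg 11)) (Assign 20 (Lit 1))
        (IfLess (Load 5 (Reg 11)) comb3_aexp (Assign 20 (Lit 1)) Skip)"
  let ?\<psi> = "\<lambda>s. comb3 q T0 T1 (regs s 14) (regs s 15) (regs s 16) (digit q (L ! regs s 17) (regs s 11))
        (digit q (L ! regs s 18) (regs s 11)) (digit q (L ! regs s 19) (regs s 11)) \<noteq> digit q i (regs s 11)"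
  let ?P' = "\<lambda>s. ?P s \<and> regs s 11 < d"
  have regs_eq: "regs s' r = regs s r" if "changes R {} s s'" "r \<notin> R" for R s s' r
    using that unfolding changes_def by simp
  have "raises_flag differs 100 20 {} ?P' ?\<psi>"
    unfolding raises_flag_def
  proof (intro conjI allI impI)
    fix s s' assume ch: "changes {20} {} s s'"
    show "?P' s' = ?P' s" "?\<psi> s' = ?\<psi> s"
      using searching_changes[OF ch, of n q d T0 T1 L i] by (simp_all add: regs_eq[OF ch])
  next
    fix s assume P: "?P' s"
    have c: "aval comb3_aexp s = comb3 q T0 T1 (regs s 14) (regs s 15) (regs s 16)
     (digit q (L ! regs s 17) (regs s 11)) (digit q (L ! regs s 18) (regs s 11))
     (digit q (L ! regs s 19) (regs s 11))"
      by (rule aval_comb3_aexp[OF T]) (use P in auto)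
    have v: "arrs s 5 (regs s 11) = digit q i (regs s 11)"
      using P unfolding searching_def by simp
    show "achieves differs 100
      (\<lambda>s'. changes {20} {} s s' \<and> regs s' 20 = (if ?\<psi> s then 1 else regs s 20)) s"
      unfolding differs_def
      by (rule achieves_le, rule achieves_IfLess, rule achieves_Assign, use c v in \<open>simp add: changes_def\<close>,
          rule achieves_IfLess, rule achieves_Assign, use c v in \<open>simp add: changes_def\<close>,
          rule achieves_Skip, use c v in \<open>simp add: changes_def\<close>)
        (simp add: comb3_aexp_def)
  qed
  then have loop: "raises_flag (For 11 2 differs) (d * (100 + 7) + 5) 20 {11} ?P
      (\<lambda>s. \<exists>j < regs s 2. ?\<psi> (s\<lparr>regs := (regs s)(11 := j)\<rparr>))"
  proof (rule raises_flag_For)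
    fix s assume "?P s"
    then show "regs s 2 \<le> d" by (simp add: searching_def prepared_def)
  next
    fix s j assume P: "?P s" and "j < regs s 2"
    then have "j < d" by (simp add: searching_def prepared_def)
    moreover have "changes {11} {} s (s\<lparr>regs := (regs s)(11 := j)\<rparr>)" by (simp add: changes_def)
    ultimately show "?P' (s\<lparr>regs := (regs s)(11 := j)\<rparr>)"
      using P searching_changes[of "{11}" s] by simp
  next
    fix s s' assume ch: "changes {20, 11} {} s s'"
    show "?P s' = ?P s"
      using searching_changes[OF ch, of n q d T0 T1 L i] by (simp_all add: regs_eq[OF ch])
  qed simp_all
  show ?thesis
    unfolding raises_flag_def
  proof (intro conjI allI impI)
    fix s s' assume ch: "changes {13, 11, 20} {} s s'"
    show "?P s' = ?P s" "?\<phi> s' = ?\<phi> s"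
      using searching_changes[OF ch, of n q d T0 T1 L i] by (simp_all add: regs_eq[OF ch])
  next
    fix s assume P: "?P s"
    let ?s1 = "s\<lparr>regs := (regs s)(20 := 0)\<rparr>"
    have ch: "changes {20} {} s ?s1" by (simp add: changes_def)
    have P1: "?P ?s1" using P searching_changes[OF ch] by simp
    have d: "regs s 2 = d" using P by (simp add: searching_def prepared_def)
    have "achieves (For 11 2 differs) (d * (100 + 7) + 5)
       (\<lambda>s'. changes {20, 11} {} ?s1 s' \<and> regs s' 20 = (if ?\<phi> s then 0 else 1)) ?s1"
      by (rule achieves_mono[OF loop[unfolded raises_flag_def, THEN conjunct2, rule_format, OF P1]])
        (auto simp: d)
    then have "achieves (For 11 2 differs) (d * (100 + 7) + 5)
        (achieves (IfLess (Reg 20) (Lit 1) (Assign 13 (Lit 1)) Skip) 6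
          (\<lambda>s'. changes {13, 11, 20} {} s s' \<and> regs s' 13 = (if ?\<phi> s then 1 else regs s 13))) ?s1"
    proof (rule achieves_mono[OF _ le_refl])
      fix s' assume "changes {20, 11} {} ?s1 s' \<and> regs s' 20 = (if ?\<phi> s then 0 else 1)"
      then have "changes {13, 11, 20} {} s s'" "regs s' 13 = regs s 13"
        and "regs s' 20 = (if ?\<phi> s then 0 else 1)"
        unfolding changes_def by auto
      then show "achieves (IfLess (Reg 20) (Lit 1) (Assign 13 (Lit 1)) Skip) 6
          (\<lambda>s'. changes {13, 11, 20} {} s s' \<and> regs s' 13 = (if ?\<phi> s then 1 else regs s 13)) s'"
        by (intro achieves_le[OF achieves_IfLess[OF achieves_Assign achieves_Skip]])
          (auto simp: changes_def split: if_splits)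
    qed
    then have "achieves compare (1 + acost (Lit 0) + (d * (100 + 7) + 5 + 6))
      (\<lambda>s'. changes {13, 11, 20} {} s s' \<and> regs s' 13 = (if ?\<phi> s then 1 else regs s 13)) s"
      unfolding compare_def differs_def[symmetric]
      by (intro achieves_Seq[OF achieves_Assign[OF achieves_Seq]]) simp
    then show "achieves compare (d * 107 + 14)
      (\<lambda>s'. changes {13, 11, 20} {} s s' \<and> regs s' 13 = (if ?\<phi> s then 1 else regs s 13)) s"
      by (rule achieves_le) simp
  qed
qed

lemma achieves_search:
  assumes T: "\<And>x. T0 x < q" "\<And>x. T1 x < q" and s: "searching n q d T0 T1 L i s"
  shows "achieves search
    (q * (q * (q * (n * (n * (n * (d * 107 + 14 + 7) + 5 + 7) + 5 + 7) + 5 + 7) + 5 + 7) + 5 + 7) + 5 + 2)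
    (\<lambda>s'. changes {11, 13, 14, 15, 16, 17, 18, 19, 20} {} s s' \<and>
       regs s' 13 = (if covered q d T0 T1 L i then 1 else 0)) s"
proof -
  let ?S = "searching n q d T0 T1 L i"
  let ?lim = "\<lambda>r. if r < 17 then q else length L"
  \<comment> \<open>\<open>P M\<close> confines the counters in \<open>M\<close> to their ranges.
    Each loop around a register discharges its range, so six applications of \<open>step\<close>
    lead from all six counters to the empty set. The budget counts \<open>n\<close> rounds where the
    program does \<open>length L\<close>, which makes it independent of the list.\<close>
  define P where "P M s \<longleftrightarrow> ?S s \<and> (\<forall>r\<in>M. regs s r < ?lim r)" for M s
  have P_eq: "P M = (\<lambda>s. ?S s \<and> (\<forall>r\<in>M. regs s r < ?lim r))" for M
    by (simp add: P_def fun_eq_iff)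
  let ?up = "\<lambda>r b \<phi> s. \<exists>i < regs s b. \<phi> (s\<lparr>regs := (regs s)(r := i)\<rparr>)"
  have step: "raises_flag (For r b c) (N * (U + 7) + 5) 13 (insert r R) (P M') (?up r b \<phi>)"
    if c: "raises_flag c U 13 R (P (insert r M')) \<phi>" and R: "insert r R \<subseteq> {11..}" "r \<notin> insert 13 R"
      and M': "M' \<inter> insert r (insert 13 R) = {}"
      and b: "b = (if r < 17 then 1 else 8)" "N = (if r < 17 then q else n)"
    for r b c N U R M' \<phi>
  proof (rule raises_flag_For[OF c])
    fix s assume "P M' s"
    then have "regs s b = ?lim r" and "?lim r \<le> N"
      using b by (auto simp: P_def searching_def prepared_def holds_def)
    then show "regs s b \<le> N" by simp
  next
    fix s x assume P: "P M' s" and "x < regs s b"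
    then have "x < ?lim r" using b P by (auto simp: P_def searching_def prepared_def holds_def)
    moreover have "changes {r} {} s (s\<lparr>regs := (regs s)(r := x)\<rparr>)" by (simp add: changes_def)
    ultimately show "P (insert r M') (s\<lparr>regs := (regs s)(r := x)\<rparr>)"
      using P searching_changes[of "{r}" s] R by (auto simp: P_def)
  next
    fix s s' assume ch: "changes (insert 13 (insert r R)) {} s s'"
    then have "\<forall>k\<in>M'. regs s' k = regs s k" using M' unfolding changes_def by blast
    then show "P M' s' = P M' s"
      using searching_changes[OF ch, of n q d T0 T1 L i] R by (simp add: P_def)
  qed (use R b in auto)
  have 0: "raises_flag compare (d * 107 + 14) 13 {11, 20} (P {19, 18, 17, 16, 15, 14})
     (\<lambda>s. \<forall>j<d. comb3 q T0 T1 (regs s 14) (regs s 15) (regs s 16) (digit q (L ! regs s 17) j)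
        (digit q (L ! regs s 18) j) (digit q (L ! regs s 19) j) = digit q i j)"
    using raises_flag_compare[of T0 q T1 d n L i] T
    by (simp add: P_eq conj_ac)
  note 1 = step[OF 0 _ _ _ refl refl, simplified]
  note 2 = step[OF 1 _ _ _ refl refl, simplified]
  note 3 = step[OF 2 _ _ _ refl refl, simplified]
  note 4 = step[OF 3 _ _ _ refl refl, simplified]
  note 5 = step[OF 4 _ _ _ refl refl, simplified]
  note 6 = step[OF 5 _ _ _ refl refl, simplified]
  have run: "achieves (For 14 1 (For 15 1 (For 16 1 (For 17 8 (For 18 8 (For 19 8 compare))))))
    (q * (q * (q * (n * (n * (n * (d * 107 + 14 + 7) + 5 + 7) + 5 + 7) + 5 + 7) + 5 + 7) + 5 + 7) + 5)
    (\<lambda>s'. changes {11, 13, 14, 15, 16, 17, 18, 19, 20} {} s s' \<and>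
       regs s' 13 = (if covered q d T0 T1 L i then 1 else regs s 13)) s" if S: "?S s" for s
  proof -
    have "regs s 1 = q" "regs s 8 = length L"
      using S by (auto simp: searching_def prepared_def holds_def)
    then show ?thesis
      using S unfolding One_nat_def
      by (intro achieves_mono[OF 6[unfolded raises_flag_def, THEN conjunct2, rule_format]])
        (simp_all add: P_def covered_def[symmetric] insert_commute)
  qed
  let ?s = "s\<lparr>regs := (regs s)(13 := 0)\<rparr>"
  have ch: "changes {13} {} s ?s" by (simp add: changes_def)
  have S': "?S ?s" using searching_changes[OF ch] s by simp
  have "achieves search
    (1 + acost (Lit 0) + (q * (q * (q * (n * (n * (n * (d * 107 + 14 + 7) + 5 + 7) + 5 + 7) + 5 + 7) + 5 + 7) + 5 + 7) + 5))
    (\<lambda>s'. changes {11, 13, 14, 15, 16, 17, 18, 19, 20} {} s s' \<and>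
       regs s' 13 = (if covered q d T0 T1 L i then 1 else 0)) s"
    unfolding search_def
    by (intro achieves_Seq[OF achieves_Assign], simp only: aval.simps,
        rule achieves_mono[OF run[OF S'] le_refl]) (simp add: changes_def)
  then show ?thesis by (rule achieves_le) simp
qed

section \<open>Extending the list, and the main loop\<close>

lemma prepared_changes:
  assumes "prepared n q d T0 T1 s" "changes R A s s'" "R \<inter> {0, 1, 2} = {}" "A \<inter> {0, 1, 3, 4} = {}"
  shows "prepared n q d T0 T1 s'"
  using assms unfolding prepared_def changes_def by (auto simp: disjoint_iff)

lemma holds_changes:
  assumes "holds q d L s" "changes R A s s'" "8 \<notin> R" "2 \<notin> A"
  shows "holds q d L s'"
  using assms unfolding holds_def changes_def by auto

definition accept :: com where
  "accept = Seq (For 11 2 (Store 2 (Plus (Load 4 (Reg 8)) (Reg 11)) (Load 5 (Reg 11))))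
     (Assign 8 (Plus (Reg 8) (Lit 1)))"

text \<open>The new row starts at \<open>length L * d\<close>, read from array 4; this needs
  \<open>length L < n\<close>, since that array is filled only below \<open>n\<close>.\<close>

lemma achieves_accept:
  assumes s: "searching n q d T0 T1 L i s" and L: "length L < n"
  shows "achieves accept (d * 15 + 9)
    (\<lambda>s'. changes {8, 11} {2} s s' \<and> holds q d (L @ [i]) s') s"
proof -
  have s8: "regs s 8 = length L" "regs s 2 = d" and s5: "\<And>j. j < d \<Longrightarrow> arrs s 5 j = digit q i j"
    and s4: "arrs s 4 (length L) = length L * d"
    and s2: "\<And>x j. x < length L \<Longrightarrow> j < d \<Longrightarrow> arrs s 2 (x * d + j) = digit q (L ! x) j"
    using s L by (auto simp: searching_def prepared_def holds_def)
  \<comment> \<open>The invariant describes all of array 2, so that the old rows, which end before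
    \<open>length L * d\<close> by \<open>prod_add_less\<close>, are seen to survive.\<close>
  let ?J = "\<lambda>m s'. changes {11} {2} s s' \<and> regs s' 11 = m \<and>
    (\<forall>x. arrs s' 2 x = (if length L * d \<le> x \<and> x < length L * d + m
       then digit q i (x - length L * d) else arrs s 2 x))"
  have "achieves accept ((d * (8 + 7) + 5) + 4)
    (\<lambda>s'. changes {8, 11} {2} s s' \<and> holds q d (L @ [i]) s') s"
    unfolding accept_def
  proof (rule achieves_le, rule achieves_Seq, rule achieves_For[where J = ?J])
    show "?J 0 (s\<lparr>regs := (regs s)(11 := 0)\<rparr>)" by (simp add: changes_def)
  next
    fix m s1 assume "?J m s1" then show "regs s1 11 = m \<and> regs s1 2 = d"
      using s8 by (simp add: changes_def)
  next
    fix m s1 assume J: "?J m s1" and m: "m < d"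
    then have "arrs s1 5 m = digit q i m" "arrs s1 4 (regs s1 8) = length L * d" "regs s1 11 = m"
      using s5[OF m] s4 s8 by (auto simp: changes_def)
    then show "achieves (Store 2 (Plus (Load 4 (Reg 8)) (Reg 11)) (Load 5 (Reg 11))) 8
        (\<lambda>s'. regs s' 11 = m \<and> ?J (Suc m) (s'\<lparr>regs := (regs s')(11 := Suc m)\<rparr>)) s1"
      using J by (intro achieves_le[OF achieves_Store]) (auto simp: changes_def)
  next
    fix s1 assume J: "?J d s1"
    have "arrs s1 2 (x * d + j) = digit q ((L @ [i]) ! x) j" if x: "x < Suc (length L)" and j: "j < d" for x j
    proof (cases "x = length L")
      case False
      with x have "x < length L" by simp
      with prod_add_less[OF this j] J s2[OF this j] show ?thesis by (simp add: nth_append)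
    qed (use J j in simp)
    moreover have "regs s1 8 = length L" using J s8 by (simp add: changes_def)
    ultimately show "achieves (Assign 8 (Plus (Reg 8) (Lit 1))) (1 + acost (Plus (Reg 8) (Lit 1)))
       (\<lambda>s'. changes {8, 11} {2} s s' \<and> holds q d (L @ [i]) s') s1"
      using J by (intro achieves_Assign) (auto simp: changes_def holds_def)
  qed simp
  then show ?thesis by (rule achieves_le) simp
qed

definition main_loop :: com where
  "main_loop = Seq (Assign 8 (Lit 0)) (Seq (Assign 9 (Lit 1))
     (WhileLess (Reg 8) (Reg 0)
       (Seq decode (Seq search (Seq (IfLess (Reg 13) (Lit 1) accept Skip)
         (Assign 9 (Plus (Reg 9) (Lit 1))))))))"

text \<open>Polymorphic, so that the same expression serves as a number in the run-time bounds and
  as a polynomial in the final statement.\<close>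

definition search_time :: "'b::comm_semiring_1 \<Rightarrow> 'b \<Rightarrow> 'b \<Rightarrow> 'b" where
  "search_time n q d =
    q * (q * (q * (n * (n * (n * (d * 107 + 14 + 7) + 5 + 7) + 5 + 7) + 5 + 7) + 5 + 7) + 5 + 7) + 5 + 2"

definition main_loop_time :: "'b::comm_semiring_1 \<Rightarrow> 'b \<Rightarrow> 'b \<Rightarrow> 'b \<Rightarrow> 'b" where
  "main_loop_time n q d N =
    N * (3 + ((d * (N * 13 + 24) + 7) + (search_time n q d + ((d * 15 + 13) + 4)))) + 7"

lemma mono_length_greedy: "i \<le> j \<Longrightarrow> length (greedy q d T0 T1 i) \<le> length (greedy q d T0 T1 j)"
  by (rule lift_Suc_mono_le[where f = "\<lambda>i. length (greedy q d T0 T1 i)"]) (simp_all add: Let_def)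

text \<open>After \<open>i\<close> rounds the list is \<open>greedy\<close> at \<open>i\<close> and
  the current candidate is \<open>i + 1\<close>. The loop stops once \<open>n\<close> vectors are
  stored, which happens within \<open>N\<close> rounds because the length never decreases.\<close>

lemma achieves_main_loop:
  assumes T: "\<And>x. T0 x < q" "\<And>x. T1 x < q" and q: "q > 1"
    and s: "prepared n q d T0 T1 s" and N: "n \<le> length (greedy q d T0 T1 N)"
  shows "achieves main_loop (main_loop_time n q d N)
     (\<lambda>s'. \<exists>i. length (greedy q d T0 T1 i) = n \<and> holds q d (greedy q d T0 T1 i) s') s"
proof -
  let ?g = "greedy q d T0 T1"
  let ?J = "\<lambda>i s. prepared n q d T0 T1 s \<and> holds q d (?g i) s \<and> length (?g i) \<le> n \<and> regs s 9 = Suc i"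
  let ?body = "Seq decode (Seq search (Seq (IfLess (Reg 13) (Lit 1) accept Skip)
         (Assign 9 (Plus (Reg 9) (Lit 1)))))"
  have body: "achieves ?body ((d * (N * 13 + 24) + 7) + (search_time n q d + ((d * 15 + 13) + 4)))
      (?J (Suc i)) s"
    if J: "?J i s" and less: "length (?g i) < n" "i < N" for i s
  proof (rule achieves_Seq, rule achieves_mono[OF achieves_decode[where q = q and d = d and x = "Suc i" and N = N] le_refl])
    fix s1 assume 1: "changes {10, 11, 12} {5} s s1 \<and> (\<forall>j<d. arrs s1 5 j = digit q (Suc i) j)"
    have p1: "prepared n q d T0 T1 s1" using prepared_changes[of n q d T0 T1 s] J 1 by fastforce
    have "holds q d (?g i) s1" using holds_changes[of q d "?g i" s] J 1 by fastforce
    then have S1: "searching n q d T0 T1 (?g i) (Suc i) s1"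
      using p1 1 less by (simp add: searching_def)
    show "achieves (Seq search (Seq (IfLess (Reg 13) (Lit 1) accept Skip) (Assign 9 (Plus (Reg 9) (Lit 1)))))
      (search_time n q d + ((d * 15 + 13) + 4)) (?J (Suc i)) s1"
    proof (rule achieves_Seq, rule achieves_mono[OF achieves_search[OF T S1]])
      fix s2 assume 2: "changes {11, 13, 14, 15, 16, 17, 18, 19, 20} {} s1 s2 \<and>
         regs s2 13 = (if covered q d T0 T1 (?g i) (Suc i) then 1 else 0)"
      then have S2: "searching n q d T0 T1 (?g i) (Suc i) s2"
        using searching_changes[of _ s1 s2 n q d T0 T1 "?g i" "Suc i"] S1 by fastforce
      have s9: "regs s2 9 = Suc i" using J 1 2 by (simp add: changes_def)
      let ?Q = "achieves (Assign 9 (Plus (Reg 9) (Lit 1))) 4 (?J (Suc i))"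
      have "achieves (IfLess (Reg 13) (Lit 1) accept Skip) (1 + acost (Reg 13) + acost (Lit 1) + (d * 15 + 9 + 1)) ?Q s2"
      proof (rule achieves_IfLess)
        assume "aval (Reg 13) s2 < aval (Lit 1) s2"
        then have nc: "\<not> covered q d T0 T1 (?g i) (Suc i)" using 2 by (simp split: if_splits)
        show "achieves accept (d * 15 + 9) ?Q s2"
        proof (rule achieves_mono[OF achieves_accept[OF S2 less(1)] le_refl])
          fix s3 assume 3: "changes {8, 11} {2} s2 s3 \<and> holds q d (?g i @ [Suc i]) s3"
          then have "prepared n q d T0 T1 s3"
            using prepared_changes[of n q d T0 T1 s2] S2 by (fastforce simp: searching_def)
          then show "?Q s3"
            using 3 nc s9 less by (intro achieves_le[OF achieves_Assign])
              (auto simp: Let_def prepared_def holds_def changes_def)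
        qed
      next
        assume "\<not> aval (Reg 13) s2 < aval (Lit 1) s2"
        then have "covered q d T0 T1 (?g i) (Suc i)" using 2 by (simp split: if_splits)
        then show "achieves Skip 1 ?Q s2"
          using S2 s9 less by (intro achieves_Skip achieves_le[OF achieves_Assign])
            (auto simp: Let_def searching_def prepared_def holds_def)
      qed
      then show "achieves (Seq (IfLess (Reg 13) (Lit 1) accept Skip) (Assign 9 (Plus (Reg 9) (Lit 1))))
          ((d * 15 + 13) + 4) (?J (Suc i)) s2"
        by (intro achieves_Seq) (erule achieves_le, simp)
    qed (simp add: search_time_def)
  qed (use J less q in \<open>auto simp: prepared_def\<close>)
  show ?thesis
    unfolding main_loop_def
  proof (rule achieves_le, rule achieves_Seq, rule achieves_Assign, rule achieves_Seq,
      rule achieves_Assign, rule achieves_WhileLess[where J = ?J and N = N])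
    fix i s assume J: "?J i s" and "aval (Reg 8) s < aval (Reg 0) s"
    then have less: "length (?g i) < n" by (simp add: holds_def prepared_def)
    then have "i < N" using N mono_length_greedy[of N i q d T0 T1] by (meson leD le_trans not_le_imp_less)
    then show "i < N \<and> achieves ?body ((d * (N * 13 + 24) + 7) + (search_time n q d + ((d * 15 + 13) + 4)))
      (?J (Suc i)) s" using body[OF J less] by blast
  next
    fix i s assume "?J i s" "\<not> aval (Reg 8) s < aval (Reg 0) s"
    then have "length (?g i) = n \<and> holds q d (?g i) s" by (simp add: holds_def prepared_def)
    then show "\<exists>i. length (?g i) = n \<and> holds q d (?g i) s" ..
  next
    show "?J 0 (s\<lparr>regs := (regs s)(8 := aval (Lit 0) s)\<rparr>\<lparr>regs := (regs (s\<lparr>regs := (regs s)(8 := aval (Lit 0) s)\<rparr>))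
        (9 := aval (Lit 1) (s\<lparr>regs := (regs s)(8 := aval (Lit 0) s)\<rparr>))\<rparr>)"
      using s by (simp add: prepared_def holds_def)
  qed (simp add: main_loop_time_def)
qed

section \<open>Multiplication, tables of multiples and the computation of \<open>d\<close>\<close>

definition multiply :: "nat \<Rightarrow> nat \<Rightarrow> nat \<Rightarrow> com" where
  "multiply r a b = Seq (Assign r (Lit 0)) (For 4 b (Assign r (Plus (Reg r) (Reg a))))"

lemma achieves_multiply:
  assumes "r \<noteq> 4" "a \<noteq> 4" "b \<noteq> 4" "r \<noteq> a" "r \<noteq> b"
  shows "achieves (multiply r a b) (regs s b * 11 + 7)
    (\<lambda>s'. changes {r, 4} {} s s' \<and> regs s' r = regs s a * regs s b) s"
proof -
  let ?J = "\<lambda>i s'. changes {r, 4} {} s s' \<and> regs s' 4 = i \<and> regs s' r = regs s a * i"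
  have "achieves (For 4 b (Assign r (Plus (Reg r) (Reg a)))) (regs s b * (4 + 7) + 5)
    (\<lambda>s'. changes {r, 4} {} s s' \<and> regs s' r = regs s a * regs s b) (s\<lparr>regs := (regs s)(r := 0)\<rparr>)"
  proof (rule achieves_For[where J = ?J])
    fix i s' assume "?J i s'"
    then show "achieves (Assign r (Plus (Reg r) (Reg a))) 4
       (\<lambda>s'. regs s' 4 = i \<and> ?J (Suc i) (s'\<lparr>regs := (regs s')(4 := Suc i)\<rparr>)) s'"
      using assms by (intro achieves_le[OF achieves_Assign]) (auto simp: changes_def)
  qed (use assms in \<open>auto simp: changes_def\<close>)
  then have "achieves (multiply r a b) (1 + acost (Lit 0) + (regs s b * (4 + 7) + 5))
    (\<lambda>s'. changes {r, 4} {} s s' \<and> regs s' r = regs s a * regs s b) s"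
    unfolding multiply_def by (intro achieves_Seq[OF achieves_Assign]) simp
  then show ?thesis by (rule achieves_le) simp
qed

definition multiples :: "nat \<Rightarrow> nat \<Rightarrow> nat \<Rightarrow> com" where
  "multiples m a b = Seq (Assign 7 (Lit 0))
     (For 4 b (Seq (Store m (Reg 4) (Reg 7)) (Assign 7 (Plus (Reg 7) (Reg a)))))"

lemma achieves_multiples:
  assumes "a \<notin> {4, 7}" "b \<notin> {4, 7}"
  shows "achieves (multiples m a b) (regs s b * 14 + 7)
    (\<lambda>s'. changes {4, 7} {m} s s' \<and> (\<forall>i < regs s b. arrs s' m i = i * regs s a)) s"
proof -
  let ?J = "\<lambda>i s'. changes {4, 7} {m} s s' \<and> regs s' 4 = i \<and> regs s' 7 = i * regs s a \<and>
    (\<forall>i' < i. arrs s' m i' = i' * regs s a)"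
  have "achieves (For 4 b (Seq (Store m (Reg 4) (Reg 7)) (Assign 7 (Plus (Reg 7) (Reg a)))))
    (regs s b * (7 + 7) + 5)
    (\<lambda>s'. changes {4, 7} {m} s s' \<and> (\<forall>i < regs s b. arrs s' m i = i * regs s a))
    (s\<lparr>regs := (regs s)(7 := 0)\<rparr>)"
  proof (rule achieves_For[where J = ?J])
    fix i s' assume "?J i s'"
    then show "achieves (Seq (Store m (Reg 4) (Reg 7)) (Assign 7 (Plus (Reg 7) (Reg a)))) 7
       (\<lambda>s'. regs s' 4 = i \<and> ?J (Suc i) (s'\<lparr>regs := (regs s')(4 := Suc i)\<rparr>)) s'"
      using assms by (intro achieves_le[OF achieves_Seq[OF achieves_Store[OF achieves_Assign]]])
        (auto simp: changes_def less_Suc_eq)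
  qed (use assms in \<open>auto simp: changes_def\<close>)
  then have "achieves (multiples m a b) (1 + acost (Lit 0) + (regs s b * (7 + 7) + 5))
    (\<lambda>s'. changes {4, 7} {m} s s' \<and> (\<forall>i < regs s b. arrs s' m i = i * regs s a)) s"
    unfolding multiples_def by (intro achieves_Seq[OF achieves_Assign]) simp
  then show ?thesis by (rule achieves_le) simp
qed

text \<open>\<open>d\<close> is found as the least number above 2 with \<open>q ^ (d - 3) \<ge> n ^ 3\<close>, which avoids logarithms.\<close>

definition prepare :: com where
  "prepare = Seq (multiply 3 0 0) (Seq (multiply 5 3 0) (Seq (Assign 6 (Lit 1)) (Seq (Assign 2 (Lit 3))
     (Seq (WhileLess (Reg 6) (Reg 5)
        (Seq (multiply 7 6 1) (Seq (Assign 6 (Reg 7)) (Assign 2 (Plus (Reg 2) (Lit 1))))))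
     (Seq (multiples 3 1 1) (multiples 4 2 0))))))"

definition prepare_time :: "'b::comm_semiring_1 \<Rightarrow> 'b \<Rightarrow> 'b \<Rightarrow> 'b" where
  "prepare_time n q d = (n * 11 + 7) + ((n * 11 + 7) + (2 + (2 +
     (d * (3 + ((q * 11 + 7) + (2 + 4))) + 3 + ((q * 14 + 7) + (n * 14 + 7))))))"

text \<open>The assumed equivalence says that the test on \<open>q ^ i\<close> succeeds exactly for
  the first \<open>d - 3\<close> values of \<open>i\<close>, so register 2, started at 3, ends at
  \<open>d\<close>.\<close>

lemma achieves_prepare:
  assumes s: "regs s 0 = n" "regs s 1 = q" "arrs s 0 = T0" "arrs s 1 = T1"
    and d: "d \<ge> 3" "\<And>i. q ^ i < n ^ 3 \<longleftrightarrow> i < d - 3"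
  shows "achieves prepare (prepare_time n q d) (prepared n q d T0 T1) s"
proof -
  let ?body = "Seq (multiply 7 6 1) (Seq (Assign 6 (Reg 7)) (Assign 2 (Plus (Reg 2) (Lit 1))))"
  let ?J = "\<lambda>i s'. changes {2, 3, 4, 5, 6, 7} {} s s' \<and> i \<le> d - 3 \<and> regs s' 2 = 3 + i \<and> regs s' 5 = n ^ 3 \<and> regs s' 6 = q ^ i"
  let ?Q = "\<lambda>s'. changes {2, 3, 4, 5, 6, 7} {} s s' \<and> regs s' 2 = d"
  have loop: "achieves (WhileLess (Reg 6) (Reg 5) ?body) (d * (3 + ((q * 11 + 7) + (2 + 4))) + 3) ?Q s1"
    if "?J 0 s1" for s1
  proof (rule achieves_le, rule achieves_WhileLess[where J = ?J and N = "d - 3"])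
    fix i s' assume J: "?J i s'" and "aval (Reg 6) s' < aval (Reg 5) s'"
    then have i: "i < d - 3" using d by simp
    have s': "regs s' 1 = q" using J s by (simp add: changes_def)
    have "achieves ?body ((regs s' 1 * 11 + 7) + (2 + 4)) (?J (Suc i)) s'"
    proof (rule achieves_Seq, rule achieves_mono[OF achieves_multiply le_refl])
      fix s2 assume "changes {7, 4} {} s' s2 \<and> regs s2 7 = regs s' 6 * regs s' 1"
      then show "achieves (Seq (Assign 6 (Reg 7)) (Assign 2 (Plus (Reg 2) (Lit 1)))) (2 + 4) (?J (Suc i)) s2"
        using J i s' by (intro achieves_le[OF achieves_Seq[OF achieves_Assign[OF achieves_Assign]]])
          (auto simp: changes_def)
    qed simp_all
    then show "i < d - 3 \<and> achieves ?body ((q * 11 + 7) + (2 + 4)) (?J (Suc i)) s'"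
      using i s' by simp
  next
    fix i s' assume J: "?J i s'" and "\<not> aval (Reg 6) s' < aval (Reg 5) s'"
    then have "i = d - 3" using d(2)[of i] by simp
    then show "?Q s'" using J d by simp
  qed (use that in auto)
  have tables: "achieves (Seq (multiples 3 1 1) (multiples 4 2 0)) ((q * 14 + 7) + (n * 14 + 7))
      (prepared n q d T0 T1) s1" if Q: "?Q s1" for s1
  proof -
    have r: "regs s1 0 = n" "regs s1 1 = q" using Q s by (auto simp: changes_def)
    have "achieves (Seq (multiples 3 1 1) (multiples 4 2 0)) ((regs s1 1 * 14 + 7) + (n * 14 + 7))
      (prepared n q d T0 T1) s1"
    proof (rule achieves_Seq, rule achieves_mono[OF achieves_multiples le_refl])
      fix s2 assume 2: "changes {4, 7} {3} s1 s2 \<and> (\<forall>i<regs s1 1. arrs s2 3 i = i * regs s1 1)"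
      then have r2: "regs s2 0 = n" "regs s2 2 = d" using r Q by (auto simp: changes_def)
      have "achieves (multiples 4 2 0) (regs s2 0 * 14 + 7) (prepared n q d T0 T1) s2"
        by (rule achieves_mono[OF achieves_multiples le_refl])
          (use 2 r r2 Q s in \<open>auto simp: changes_def prepared_def\<close>)
      then show "achieves (multiples 4 2 0) (n * 14 + 7) (prepared n q d T0 T1) s2"
        using r2 by simp
    qed simp_all
    then show ?thesis using r by simp
  qed
  let ?C = "Seq (Assign 6 (Lit 1)) (Seq (Assign 2 (Lit 3))
     (Seq (WhileLess (Reg 6) (Reg 5) ?body) (Seq (multiples 3 1 1) (multiples 4 2 0))))"
  let ?t = "2 + (2 + (d * (3 + ((q * 11 + 7) + (2 + 4))) + 3 + ((q * 14 + 7) + (n * 14 + 7))))"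
  have rest: "achieves ?C ?t (prepared n q d T0 T1) s1"
    if s1: "changes {3, 4, 5} {} s s1" "regs s1 5 = n ^ 3" for s1
  proof (rule achieves_le, rule achieves_Seq, rule achieves_Assign, rule achieves_Seq,
      rule achieves_Assign, rule achieves_Seq, rule achieves_mono[OF loop le_refl])
    fix s2 assume "?Q s2"
    then show "achieves (Seq (multiples 3 1 1) (multiples 4 2 0)) ((q * 14 + 7) + (n * 14 + 7))
      (prepared n q d T0 T1) s2" by (rule tables)
  qed (use s1 in \<open>auto simp: changes_def\<close>)
  have "achieves prepare ((regs s 0 * 11 + 7) + ((n * 11 + 7) + ?t)) (prepared n q d T0 T1) s"
    unfolding prepare_def
  proof (rule achieves_Seq, rule achieves_mono[OF achieves_multiply le_refl])
    fix s1 assume 1: "changes {3, 4} {} s s1 \<and> regs s1 3 = regs s 0 * regs s 0"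
    then have r1: "regs s1 0 = n" "regs s1 3 = n * n" using s by (auto simp: changes_def)
    have "achieves (Seq (multiply 5 3 0) ?C) ((regs s1 0 * 11 + 7) + ?t) (prepared n q d T0 T1) s1"
    proof (rule achieves_Seq, rule achieves_mono[OF achieves_multiply le_refl])
      fix s2 assume "changes {5, 4} {} s1 s2 \<and> regs s2 5 = regs s1 3 * regs s1 0"
      then have "changes {3, 4, 5} {} s s2" "regs s2 5 = n ^ 3"
        using conjunct1[OF 1] r1 by (simp_all add: changes_def power3_eq_cube)
      then show "achieves ?C ?t (prepared n q d T0 T1) s2" by (rule rest)
    qed simp_all
    then show "achieves (Seq (multiply 5 3 0) ?C) ((n * 11 + 7) + ?t) (prepared n q d T0 T1) s1"
      using r1 by simp
  qed simp_all
  then show ?thesis using s by (simp add: prepare_time_def)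
qed

section \<open>Combinations of three vectors\<close>

context vectorspace begin

text \<open>Repetitions are allowed, so a nonempty \<open>W\<close> gets the spans of all its
  subsets of size at most 3; for empty \<open>W\<close> the result is empty instead of the zero
  space.\<close>

definition combinations3 :: "'c set \<Rightarrow> 'c set" where
  "combinations3 W = (\<lambda>(a, b, c, x, y, z). (a \<odot>\<^bsub>V\<^esub> x \<oplus>\<^bsub>V\<^esub> b \<odot>\<^bsub>V\<^esub> y) \<oplus>\<^bsub>V\<^esub> c \<odot>\<^bsub>V\<^esub> z) `
     (carrier K \<times> carrier K \<times> carrier K \<times> W \<times> W \<times> W)"

lemma combinations3I:
  "\<lbrakk>v = (a \<odot>\<^bsub>V\<^esub> x \<oplus>\<^bsub>V\<^esub> b \<odot>\<^bsub>V\<^esub> y) \<oplus>\<^bsub>V\<^esub> c \<odot>\<^bsub>V\<^esub> z; a \<in> carrier K; b \<in> carrier K; c \<in> carrier K;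
    x \<in> W; y \<in> W; z \<in> W\<rbrakk> \<Longrightarrow> v \<in> combinations3 W"
  unfolding combinations3_def by force

lemma combinations3_mono: "W \<subseteq> W' \<Longrightarrow> combinations3 W \<subseteq> combinations3 W'"
  unfolding combinations3_def by (intro image_mono) auto

lemma combinations3_empty: "combinations3 {} = {}"
  unfolding combinations3_def by simp

lemma combinations3_superset: "W \<subseteq> carrier V \<Longrightarrow> W \<subseteq> combinations3 W"
proof
  fix x assume "W \<subseteq> carrier V" "x \<in> W"
  then show "x \<in> combinations3 W"
    by (intro combinations3I[of x "\<one>\<^bsub>K\<^esub>" x "\<zero>\<^bsub>K\<^esub>" x "\<zero>\<^bsub>K\<^esub>" x]) auto
qed

lemma zero_in_combinations3: "W \<subseteq> carrier V \<Longrightarrow> W \<noteq> {} \<Longrightarrow> \<zero>\<^bsub>V\<^esub> \<in> combinations3 W"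
proof -
  assume "W \<subseteq> carrier V" "W \<noteq> {}"
  then obtain x where "x \<in> W" "x \<in> carrier V" by auto
  then show ?thesis
    by (intro combinations3I[of _ "\<zero>\<^bsub>K\<^esub>" x "\<zero>\<^bsub>K\<^esub>" x "\<zero>\<^bsub>K\<^esub>" x]) auto
qed

lemma card_combinations3:
  assumes "finite (carrier K)" "finite W"
  shows "card (combinations3 W) \<le> (card (carrier K) * card W) ^ 3"
proof -
  let ?X = "carrier K \<times> carrier K \<times> carrier K \<times> W \<times> W \<times> W"
  have "card (combinations3 W) \<le> card ?X"
    unfolding combinations3_def using assms by (intro card_image_le) auto
  also have "card ?X = (card (carrier K) * card W) ^ 3"
    by (simp add: card_cartesian_product power3_eq_cube)
  finally show ?thesis .
qed

lemma lincomb_insert':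
  "\<lbrakk>finite S; S \<subseteq> carrier V; v \<in> carrier V; v \<notin> S; a \<in> insert v S \<rightarrow> carrier K\<rbrakk> \<Longrightarrow>
    lincomb a (insert v S) = a v \<odot>\<^bsub>V\<^esub> v \<oplus>\<^bsub>V\<^esub> lincomb a S"
  using lincomb_insert[of S a v] by (simp add: Un_commute)

lemma lincomb_empty: "lincomb a {} = \<zero>\<^bsub>V\<^esub>"
  by (simp add: lincomb_def)

text \<open>Smaller sets are padded with zero coefficients on repeated vectors; for empty
  \<open>B\<close> the padding vector comes from \<open>W \<noteq> {}\<close>.\<close>

lemma span_subset_combinations3:
  assumes B: "B \<subseteq> W" "finite B" "card B \<le> 3" and W: "W \<subseteq> carrier V" "W \<noteq> {}"
  shows "span B \<subseteq> combinations3 W"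
proof
  fix v assume "v \<in> span B"
  then obtain a where a: "a \<in> B \<rightarrow> carrier K" and v: "v = lincomb a B"
    using finite_span[of B] B W by auto
  obtain w where w: "w \<in> W" "w \<in> carrier V" using W by auto
  have BV: "B \<subseteq> carrier V" using B W by auto
  consider "card B = 0" | "card B = 1" | "card B = 2" | "card B = 3" using B(3) by linarith
  then show "v \<in> combinations3 W"
  proof cases
    case 1
    then have "B = {}" using B(2) by simp
    then show ?thesis using v zero_in_combinations3[OF W] by (simp add: lincomb_empty)
  next
    case 2
    then obtain x where Bx: "B = {x}" by (auto simp: card_1_singleton_iff)
    then show ?thesis using v a w B BV
      by (intro combinations3I[of v "a x" x "\<zero>\<^bsub>K\<^esub>" x "\<zero>\<^bsub>K\<^esub>" x]) (auto simp: lincomb_insert' lincomb_empty)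
  next
    case 3
    then obtain x y where Bx: "B = {x, y}" "x \<noteq> y" by (auto simp: card_2_iff)
    then show ?thesis using v a w B BV
      by (intro combinations3I[of v "a x" x "a y" y "\<zero>\<^bsub>K\<^esub>" x]) (auto simp: lincomb_insert' lincomb_empty)
  next
    case 4
    then obtain x y z where Bx: "B = {x, y, z}" "x \<noteq> y" "x \<noteq> z" "y \<noteq> z" by (auto simp: card_3_iff)
    then show ?thesis using v a w B BV
      by (intro combinations3I[of v "a x" x "a y" y "a z" z])
        (auto simp: lincomb_insert' lincomb_empty M.a_assoc)
  qed
qed

text \<open>In a set of at most four vectors, remove the one chosen last: the others, at most three,
  are independent by induction, and their span lies in \<open>combinations3\<close> of the earlier
  vectors, which the last one avoids. Injectivity follows because a repeated vector is a combination
  of its earlier copy.\<close>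

lemma four_term_independent_greedy:
  fixes v :: "nat \<Rightarrow> 'c"
  assumes v: "\<And>k. k < n \<Longrightarrow> v k \<in> carrier V" "\<And>k. k < n \<Longrightarrow> v k \<noteq> \<zero>\<^bsub>V\<^esub>"
    and new: "\<And>k. k < n \<Longrightarrow> v k \<notin> combinations3 (v ` {..<k})"
  shows "four_term_independent K V (v ` {..<n})" and "inj_on v {..<n}"
proof -
  have "lin_indpt S" if "S \<subseteq> v ` {..<k}" "finite S" "card S \<le> 4" "k \<le> n" for S k
    using that
  proof (induction k arbitrary: S)
    case 0
    then show ?case by (auto simp: lin_dep_def)
  next
    case (Suc k)
    have carr: "v ` {..<k} \<subseteq> carrier V" and k: "k < n" using Suc.prems v by auto
    show ?case
    proof (cases "v k \<in> S")
      case False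
      then have "S \<subseteq> v ` {..<k}" using Suc.prems(1) by (auto simp: lessThan_Suc)
      then show ?thesis using Suc by simp
    next
      case True
      define B where "B = S - {v k}"
      have S: "S = B \<union> {v k}" using True B_def by auto
      have B: "B \<subseteq> v ` {..<k}" "finite B" "card B \<le> 3"
        using Suc.prems True by (auto simp: B_def lessThan_Suc)
      have ind: "lin_indpt B" using Suc.IH[OF B(1,2)] B(3) k by simp
      have "v k \<notin> span B"
      \<comment> \<open>At \<open>k = 0\<close> the span is the zero space while
        \<open>combinations3 {}\<close> is empty; that \<open>v 0\<close> is nonzero fills this
        gap.\<close>
      proof (cases "k = 0")
        case True
        then have "B = {}" using B by simp
        then have "span B = {\<zero>\<^bsub>V\<^esub>}" by (auto simp: finite_span lincomb_empty)
        then show ?thesis using v(2)[OF k] by simp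
      next
        case False
        then have "v ` {..<k} \<noteq> {}" by auto
        from span_subset_combinations3[OF B carr this] new[OF k] show ?thesis by blast
      qed
      moreover have "B \<subseteq> carrier V" "v k \<notin> B" using B carr by (auto simp: B_def)
      ultimately show ?thesis
        using lin_dep_iff_in_span[of B "v k"] ind v(1)[OF k] S by simp
    qed
  qed
  then show "four_term_independent K V (v ` {..<n})"
    unfolding four_term_independent_def using v by auto
  have "v i \<noteq> v j" if "i < j" "j < n" for i j
  proof -
    have "v ` {..<j} \<subseteq> carrier V" using v(1) that by auto
    then have "v i \<in> combinations3 (v ` {..<j})" using combinations3_superset that by blast
    then show ?thesis using new[OF that(2)] by auto
  qed
  then show "inj_on v {..<n}"
    by (intro linorder_inj_onI) auto
qed

text \<open>With all on one side, four distinct vectors force \<open>a\<close> to vanish. If a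
  vector occurs on both sides in the same place, it cancels; if it occurs in opposite places, a
  relation among three vectors remains.\<close>

lemma four_term_independent_imp_linear_Sidon:
  assumes S: "four_term_independent K V S"
  shows "linear_Sidon K V S"
  unfolding linear_Sidon_def
proof (intro conjI ballI impI)
  show SV: "S \<subseteq> carrier V" using S by (simp add: four_term_independent_def)
  have indpt: "f w = \<zero>\<^bsub>K\<^esub>"
    if "B \<subseteq> S" "finite B" "card B \<le> 4" "f \<in> B \<rightarrow> carrier K" "lincomb f B = \<zero>\<^bsub>V\<^esub>" "w \<in> B" for B f w
    using that S lin_dep_crit[of B B f w] unfolding four_term_independent_def by blast
  have cancel: "x = y" if "a \<in> carrier K - {\<zero>\<^bsub>K\<^esub>}" "x \<in> S" "y \<in> S" "a \<odot>\<^bsub>V\<^esub> x = a \<odot>\<^bsub>V\<^esub> y" for a x y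
  proof -
    have "y \<in> carrier V" "x \<in> carrier V" using that SV by auto
    then show ?thesis
      using that mult_inverse[of a x "a \<odot>\<^bsub>V\<^esub> x"] mult_inverse[of a y "a \<odot>\<^bsub>V\<^esub> y"] by simp
  qed
  \<comment> \<open>The shared vector \<open>x\<close> gets the coefficient \<open>a - a'\<close>,
    which may be zero, so the contradiction is drawn from the coefficient of
    \<open>y\<close>.\<close>
  have no_relation: "b = \<zero>\<^bsub>K\<^esub>"
    if "a \<in> carrier K" "b \<in> carrier K" "c \<in> carrier K" "x \<in> S" "y \<in> S" "z \<in> S" "x \<noteq> y" "x \<noteq> z" "y \<noteq> z"
      and eq: "a \<odot>\<^bsub>V\<^esub> x \<oplus>\<^bsub>V\<^esub> b \<odot>\<^bsub>V\<^esub> y = a' \<odot>\<^bsub>V\<^esub> x \<oplus>\<^bsub>V\<^esub> c \<odot>\<^bsub>V\<^esub> z" "a' \<in> carrier K" for a a' b c x y z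
  proof -
    let ?f = "\<lambda>w. if w = x then a \<ominus>\<^bsub>K\<^esub> a' else if w = y then b else \<ominus>\<^bsub>K\<^esub> c"
    have V: "x \<in> carrier V" "y \<in> carrier V" "z \<in> carrier V" using that SV by auto
    have "lincomb ?f {x, y, z} = (a \<ominus>\<^bsub>K\<^esub> a') \<odot>\<^bsub>V\<^esub> x \<oplus>\<^bsub>V\<^esub> (b \<odot>\<^bsub>V\<^esub> y \<oplus>\<^bsub>V\<^esub> (\<ominus>\<^bsub>K\<^esub> c) \<odot>\<^bsub>V\<^esub> z)"
      using that V by (auto simp: lincomb_insert' lincomb_empty)
    also have "\<dots> = (a \<odot>\<^bsub>V\<^esub> x \<oplus>\<^bsub>V\<^esub> b \<odot>\<^bsub>V\<^esub> y) \<oplus>\<^bsub>V\<^esub> \<ominus>\<^bsub>V\<^esub> (a' \<odot>\<^bsub>V\<^esub> x \<oplus>\<^bsub>V\<^esub> c \<odot>\<^bsub>V\<^esub> z)"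
      using that(1-3,11) V by (simp add: a_minus_def smult_l_distr smult_l_minus M.a_ac M.minus_add)
    also have "\<dots> = \<zero>\<^bsub>V\<^esub>" using that V eq by (simp add: M.r_neg)
    finally have "?f y = \<zero>\<^bsub>K\<^esub>"
      by (intro indpt[of "{x, y, z}"]) (use that in auto)
    then show ?thesis using that by simp
  qed
  fix a b x y x' y'
  assume ab: "a \<in> carrier K - {\<zero>\<^bsub>K\<^esub>}" "b \<in> carrier K - {\<zero>\<^bsub>K\<^esub>}"
    and S: "x \<in> S" "y \<in> S" "x' \<in> S" "y' \<in> S"
    and H: "x \<noteq> y \<and> x' \<noteq> y' \<and> a \<odot>\<^bsub>V\<^esub> x \<oplus>\<^bsub>V\<^esub> b \<odot>\<^bsub>V\<^esub> y = a \<odot>\<^bsub>V\<^esub> x' \<oplus>\<^bsub>V\<^esub> b \<odot>\<^bsub>V\<^esub> y'"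
  have V: "x \<in> carrier V" "y \<in> carrier V" "x' \<in> carrier V" "y' \<in> carrier V" using S SV by auto
  have eq: "a \<odot>\<^bsub>V\<^esub> x \<oplus>\<^bsub>V\<^esub> b \<odot>\<^bsub>V\<^esub> y = a \<odot>\<^bsub>V\<^esub> x' \<oplus>\<^bsub>V\<^esub> b \<odot>\<^bsub>V\<^esub> y'" using H by simp
  show "{x, y} = {x', y'}"
  proof (rule ccontr)
    assume ne: "{x, y} \<noteq> {x', y'}"
    \<comment> \<open>The cases overlap. In the crossed cases 3 and 4 the remaining two vectors are
      distinct because otherwise the two pairs would coincide.\<close>
    consider "x = x'" | "y = y'" | "x \<noteq> x'" "x = y'" | "y \<noteq> y'" "y = x'"
      | "x \<noteq> x'" "x \<noteq> y'" "y \<noteq> x'" "y \<noteq> y'" by blast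
    then show False
    proof cases
      case 1
      then have "b \<odot>\<^bsub>V\<^esub> y = b \<odot>\<^bsub>V\<^esub> y'" using eq ab V by simp
      with 1 cancel ab S ne show False by blast
    next
      case 2
      then have "a \<odot>\<^bsub>V\<^esub> x = a \<odot>\<^bsub>V\<^esub> x'" using eq ab V by simp
      with 2 cancel ab S ne show False by blast
    next
      case 3
      then have "a \<odot>\<^bsub>V\<^esub> x \<oplus>\<^bsub>V\<^esub> b \<odot>\<^bsub>V\<^esub> y = b \<odot>\<^bsub>V\<^esub> x \<oplus>\<^bsub>V\<^esub> a \<odot>\<^bsub>V\<^esub> x'"
        using eq ab V by (simp add: M.a_comm)
      then have "b = \<zero>\<^bsub>K\<^esub>" by (intro no_relation[of a b a x y x' b]) (use 3 H ab S ne in auto)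
      then show False using ab by simp
    next
      case 4
      then have "b \<odot>\<^bsub>V\<^esub> y \<oplus>\<^bsub>V\<^esub> a \<odot>\<^bsub>V\<^esub> x = a \<odot>\<^bsub>V\<^esub> y \<oplus>\<^bsub>V\<^esub> b \<odot>\<^bsub>V\<^esub> y'"
        using eq ab V by (simp add: M.a_comm)
      then have "a = \<zero>\<^bsub>K\<^esub>" by (intro no_relation[of b a b y x y' a]) (use 4 H ab S ne in auto)
      then show False using ab by simp
    next
      case 5
      let ?B = "{x, y, x', y'}"
      let ?f = "\<lambda>w. if w = x then a else if w = y then b else if w = x' then \<ominus>\<^bsub>K\<^esub> a else \<ominus>\<^bsub>K\<^esub> b"
      have "lincomb ?f ?B = a \<odot>\<^bsub>V\<^esub> x \<oplus>\<^bsub>V\<^esub> (b \<odot>\<^bsub>V\<^esub> y \<oplus>\<^bsub>V\<^esub> ((\<ominus>\<^bsub>K\<^esub> a) \<odot>\<^bsub>V\<^esub> x' \<oplus>\<^bsub>V\<^esub> (\<ominus>\<^bsub>K\<^esub> b) \<odot>\<^bsub>V\<^esub> y'))"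
        using 5 H ab V by (auto simp: lincomb_insert' lincomb_empty)
      also have "\<dots> = (a \<odot>\<^bsub>V\<^esub> x \<oplus>\<^bsub>V\<^esub> b \<odot>\<^bsub>V\<^esub> y) \<oplus>\<^bsub>V\<^esub> \<ominus>\<^bsub>V\<^esub> (a \<odot>\<^bsub>V\<^esub> x' \<oplus>\<^bsub>V\<^esub> b \<odot>\<^bsub>V\<^esub> y')"
        using ab V by (simp add: smult_l_minus M.a_assoc M.minus_add)
      also have "\<dots> = \<zero>\<^bsub>V\<^esub>" using ab V eq by (simp add: M.r_neg)
      finally have "?f x = \<zero>\<^bsub>K\<^esub>"
        by (intro indpt[of ?B ?f x]) (use ab S 5 H in auto)
      then show False using ab by simp
    qed
  qed
qed

end

section \<open>Base-\<open>q\<close> digits and the size of \<open>d\<close>\<close>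

lemma digits_exist:
  "(\<And>j. j < d \<Longrightarrow> f j < q) \<Longrightarrow> \<exists>i < q ^ d::nat. \<forall>j<d. i div q ^ j mod q = f j"
proof (induction d arbitrary: f)
  case 0
  show ?case by (intro exI[of _ 0]) simp
next
  case (Suc d)
  obtain i where i: "i < q ^ d" "\<And>j. j < d \<Longrightarrow> i div q ^ j mod q = f (Suc j)"
    using Suc.IH[of "\<lambda>j. f (Suc j)"] Suc.prems by auto
  have f0: "f 0 < q" using Suc.prems by simp
  have "f 0 + q * i < q ^ Suc d"
  proof -
    have "f 0 + q * i < q * Suc i" using f0 by simp
    also have "\<dots> \<le> q * q ^ d" using i(1) by (intro mult_le_mono2) simp
    finally show ?thesis by simp
  qed
  moreover have "(f 0 + q * i) div q ^ j mod q = f j" if "j < Suc d" for j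
    using that i(2) f0 by (cases j) (simp_all add: div_mult2_eq)
  ultimately show ?case by blast
qed

text \<open>An integer lies below a ceiling iff it lies below the number itself, so
  \<open>d - 3\<close> is the least exponent with \<open>q ^ (d - 3) \<ge> n ^ 3\<close>. This
  replaces logarithms by integer arithmetic from here on.\<close>

lemma dimension_bounds:
  assumes q: "q \<ge> 2" and n: "n \<ge> 1" and d: "d = nat \<lceil>3 * ln (real n) / ln (real q) + 3\<rceil>"
  shows "d \<ge> 3" and "q ^ i < n ^ 3 \<longleftrightarrow> i < d - 3"
proof -
  let ?x = "3 * ln (real n) / ln (real q)"
  have x: "?x \<ge> 0" and lq: "ln (real q) > 0" using q n by auto
  then have d': "d = nat \<lceil>?x\<rceil> + 3" unfolding d by (simp add: nat_add_distrib)
  show "d \<ge> 3" using d' by simp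
  have "i < d - 3 \<longleftrightarrow> real i < ?x"
    using d' x by (simp add: zless_nat_eq_int_zless less_ceiling_iff)
  also have "\<dots> \<longleftrightarrow> real i * ln (real q) < 3 * ln (real n)" using lq by (simp add: field_simps)
  also have "\<dots> \<longleftrightarrow> ln (real q ^ i) < ln (real n ^ 3)" using q n by (simp add: ln_realpow)
  also have "\<dots> \<longleftrightarrow> real (q ^ i) < real (n ^ 3)" using q n by simp
  finally show "q ^ i < n ^ 3 \<longleftrightarrow> i < d - 3" by (simp only: of_nat_less_iff)
qed

section \<open>Correctness\<close>

locale coded_field = field F for F :: "('a, 'r) ring_scheme" (structure) +
  fixes e :: "nat \<Rightarrow> 'a" and q d :: nat and T0 T1 :: "nat \<Rightarrow> nat"
  assumes finite_F: "finite (carrier F)" and q: "q = card (carrier F)"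
    and e: "bij_betw e {..<q} (carrier F)"
    and T0_less: "T0 x < q" and T1_less: "T1 x < q"
    and T0: "a < q \<Longrightarrow> b < q \<Longrightarrow> e (T0 (a * q + b)) = e a \<oplus> e b"
    and T1: "a < q \<Longrightarrow> b < q \<Longrightarrow> e (T1 (a * q + b)) = e a \<otimes> e b"
    and d: "d \<ge> 2"
begin

abbreviation "Vd \<equiv> coord_space F d"

sublocale V: vectorspace F Vd
  unfolding vectorspace_def using func_space_is_module[of "{..<d}"] field_axioms
  by (simp add: module_def)

lemma q_ge_2: "q \<ge> 2"
proof -
  have "card {\<zero>, \<one>} \<le> q" unfolding q by (intro card_mono finite_F) auto
  then show ?thesis by simp
qed

lemma e_carrier: "a < q \<Longrightarrow> e a \<in> carrier F"
  using e by (auto simp: bij_betw_def)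

lemma e_eq_iff: "a < q \<Longrightarrow> b < q \<Longrightarrow> e a = e b \<longleftrightarrow> a = b"
  using e by (auto simp: bij_betw_def inj_on_def)

lemma e_surj: "x \<in> carrier F \<Longrightarrow> \<exists>a<q. e a = x"
proof -
  assume "x \<in> carrier F"
  then have "x \<in> e ` {..<q}" using e by (simp add: bij_betw_def)
  then show ?thesis by auto
qed

lemma digit_less: "digit q i j < q"
  using q_ge_2 by (simp add: digit_def)

definition vec :: "nat \<Rightarrow> nat \<Rightarrow> 'a" where
  "vec i = (\<lambda>j\<in>{..<d}. e (digit q i j))"

lemma carrier_Vd: "carrier Vd = {..<d} \<rightarrow>\<^sub>E carrier F"
  by (simp add: func_space_def)

lemma vec_carrier: "vec i \<in> carrier Vd"
  by (auto simp: carrier_Vd vec_def e_carrier digit_less)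

lemma vec_surj: "v \<in> carrier Vd \<Longrightarrow> \<exists>i<q^d. vec i = v"
proof -
  assume v: "v \<in> carrier Vd"
  then have "\<exists>a<q. e a = v j" if "j < d" for j using e_surj that by (auto simp: carrier_Vd)
  then obtain f where f: "\<And>j. j < d \<Longrightarrow> f j < q \<and> e (f j) = v j" by metis
  then obtain i where i: "i < q ^ d" "\<And>j. j < d \<Longrightarrow> digit q i j = f j"
    using digits_exist[of d f q] by (auto simp: digit_def)
  have "vec i = v"
    using v f i by (intro extensionalityI[of _ "{..<d}"]) (auto simp: vec_def carrier_Vd PiE_def)
  then show ?thesis using i(1) by blast
qed

lemma comb3_code:
  assumes "a < q" "b < q" "c < q" "u < q" "v < q" "w < q"
  shows "e (comb3 q T0 T1 a b c u v w) = (e a \<otimes> e u \<oplus> e b \<otimes> e v) \<oplus> e c \<otimes> e w"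
  using assms by (simp add: comb3_def T0 T1 T0_less T1_less)

text \<open>Codes are compared instead of elements, which is the same since \<open>e\<close> is
  injective on codes; surjectivity turns coefficients of the field into codes.\<close>

lemma covered_iff: "covered q d T0 T1 L i \<longleftrightarrow> vec i \<in> V.combinations3 (vec ` set L)"
proof -
  have eq: "(\<forall>j<d. comb3 q T0 T1 a b c (digit q x j) (digit q y j) (digit q z j) = digit q i j) \<longleftrightarrow>
    vec i = (e a \<odot>\<^bsub>Vd\<^esub> vec x \<oplus>\<^bsub>Vd\<^esub> e b \<odot>\<^bsub>Vd\<^esub> vec y) \<oplus>\<^bsub>Vd\<^esub> e c \<odot>\<^bsub>Vd\<^esub> vec z"
    if "a < q" "b < q" "c < q" for a b c x y z
  proof -
    have "vec i = (e a \<odot>\<^bsub>Vd\<^esub> vec x \<oplus>\<^bsub>Vd\<^esub> e b \<odot>\<^bsub>Vd\<^esub> vec y) \<oplus>\<^bsub>Vd\<^esub> e c \<odot>\<^bsub>Vd\<^esub> vec z \<longleftrightarrow>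
      (\<forall>j<d. e (digit q i j) = (e a \<otimes> e (digit q x j) \<oplus> e b \<otimes> e (digit q y j)) \<oplus> e c \<otimes> e (digit q z j))"
      by (auto simp: func_space_def vec_def fun_eq_iff restrict_def)
    also have "\<dots> \<longleftrightarrow> (\<forall>j<d. e (digit q i j) = e (comb3 q T0 T1 a b c (digit q x j) (digit q y j) (digit q z j)))"
      using that by (simp add: comb3_code digit_less)
    also have "\<dots> \<longleftrightarrow> (\<forall>j<d. digit q i j = comb3 q T0 T1 a b c (digit q x j) (digit q y j) (digit q z j))"
      by (simp add: e_eq_iff digit_less comb3_def T0_less)
    finally show ?thesis by auto
  qed
  have "covered q d T0 T1 L i \<longleftrightarrow> (\<exists>a<q. \<exists>b<q. \<exists>c<q. \<exists>x\<in>set L. \<exists>y\<in>set L. \<exists>z\<in>set L.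
      vec i = (e a \<odot>\<^bsub>Vd\<^esub> vec x \<oplus>\<^bsub>Vd\<^esub> e b \<odot>\<^bsub>Vd\<^esub> vec y) \<oplus>\<^bsub>Vd\<^esub> e c \<odot>\<^bsub>Vd\<^esub> vec z)"
  proof -
    have "(\<exists>x\<in>set L. P x) \<longleftrightarrow> (\<exists>k<length L. P (L ! k))" for P :: "nat \<Rightarrow> bool"
      by (metis in_set_conv_nth)
    then show ?thesis unfolding covered_def by (simp add: eq cong: conj_cong)
  qed
  also have "\<dots> \<longleftrightarrow> vec i \<in> V.combinations3 (vec ` set L)"
  proof
    assume "\<exists>a<q. \<exists>b<q. \<exists>c<q. \<exists>x\<in>set L. \<exists>y\<in>set L. \<exists>z\<in>set L.
      vec i = (e a \<odot>\<^bsub>Vd\<^esub> vec x \<oplus>\<^bsub>Vd\<^esub> e b \<odot>\<^bsub>Vd\<^esub> vec y) \<oplus>\<^bsub>Vd\<^esub> e c \<odot>\<^bsub>Vd\<^esub> vec z"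
    then show "vec i \<in> V.combinations3 (vec ` set L)"
      by (blast intro: V.combinations3I e_carrier)
  next
    assume "vec i \<in> V.combinations3 (vec ` set L)"
    then obtain a b c x y z where "a \<in> carrier F" "b \<in> carrier F" "c \<in> carrier F"
      "x \<in> set L" "y \<in> set L" "z \<in> set L"
      "vec i = (a \<odot>\<^bsub>Vd\<^esub> vec x \<oplus>\<^bsub>Vd\<^esub> b \<odot>\<^bsub>Vd\<^esub> vec y) \<oplus>\<^bsub>Vd\<^esub> c \<odot>\<^bsub>Vd\<^esub> vec z"
      unfolding V.combinations3_def by auto
    then show "\<exists>a<q. \<exists>b<q. \<exists>c<q. \<exists>x\<in>set L. \<exists>y\<in>set L. \<exists>z\<in>set L.
      vec i = (e a \<odot>\<^bsub>Vd\<^esub> vec x \<oplus>\<^bsub>Vd\<^esub> e b \<odot>\<^bsub>Vd\<^esub> vec y) \<oplus>\<^bsub>Vd\<^esub> e c \<odot>\<^bsub>Vd\<^esub> vec z"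
      using e_surj by metis
  qed
  finally show ?thesis .
qed

abbreviation "chosen \<equiv> greedy q d T0 T1"

text \<open>A rejected candidate was covered when tested and stays so as the list grows; an accepted
  one is a combination of itself.\<close>

lemma vec_in_combinations3_chosen:
  "1 \<le> i \<Longrightarrow> i \<le> m \<Longrightarrow> vec i \<in> V.combinations3 (vec ` set (chosen m))"
proof (induction m)
  case (Suc m)
  let ?L = "chosen m"
  have sub: "vec ` set ?L \<subseteq> vec ` set (chosen (Suc m))" by (auto simp: Let_def)
  show ?case
  proof (cases "i \<le> m")
    case True
    then show ?thesis using Suc V.combinations3_mono[OF sub] by auto
  next
    case False
    then have i: "i = Suc m" using Suc.prems by simp
    show ?thesis
    proof (cases "covered q d T0 T1 ?L i")
      case True
      then show ?thesis using V.combinations3_mono[OF sub] by (auto simp: covered_iff)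
    next
      case False
      then have "vec i \<in> vec ` set (chosen (Suc m))" using i by (simp add: Let_def)
      moreover have sub: "vec ` set (chosen (Suc m)) \<subseteq> carrier Vd" using vec_carrier by blast
      ultimately show ?thesis using subsetD[OF V.combinations3_superset[OF sub]] by simp
    qed
  qed
qed simp

text \<open>The list grows only at its end, so the entries before position \<open>k\<close> are
  exactly those against which the entry at \<open>k\<close> was tested.\<close>

lemma chosen_new:
  "k < length (chosen m) \<Longrightarrow>
    vec (chosen m ! k) \<notin> V.combinations3 ((\<lambda>k. vec (chosen m ! k)) ` {..<k})"
proof (induction m)
  case (Suc m)
  let ?L = "chosen m"
  have img: "(\<lambda>l. vec ((?L @ [Suc m]) ! l)) ` {..<k} = (\<lambda>l. vec (?L ! l)) ` {..<k}" if "k \<le> length ?L"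
    using that by (intro image_cong) (auto simp: nth_append)
  have all: "(\<lambda>l. vec (?L ! l)) ` {..<length ?L} = vec ` set ?L"
    by (auto simp: set_conv_nth)
  show ?case
  proof (cases "covered q d T0 T1 ?L (Suc m)")
    case True
    then show ?thesis using Suc by (simp add: Let_def)
  next
    case False
    then have C: "chosen (Suc m) = ?L @ [Suc m]" by (simp add: Let_def)
    show ?thesis
    proof (cases "k < length ?L")
      case True
      then show ?thesis unfolding C using Suc.IH img by (simp add: nth_append)
    next
      case k: False
      then have "k = length ?L" using Suc.prems C by simp
      then show ?thesis unfolding C using False img all by (simp add: covered_iff)
    qed
  qed
qed simp

lemma chosen_first: "m \<ge> 1 \<Longrightarrow> chosen m \<noteq> [] \<and> hd (chosen m) = 1"
proof (induction m rule: dec_induct)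
  case base
  show ?case by (simp add: covered_iff V.combinations3_empty)
qed (auto simp: Let_def)

text \<open>Whatever the code of zero, the digits of 1 at positions 0 and 1 differ, so at least one
  of these coordinates is nonzero. This uses \<open>d \<ge> 2\<close>.\<close>

lemma vec_1_nonzero: "vec 1 \<noteq> \<zero>\<^bsub>Vd\<^esub>"
proof
  assume "vec 1 = \<zero>\<^bsub>Vd\<^esub>"
  then have 0: "e (digit q 1 j) = \<zero>" if "j < d" for j
    using that by (auto simp: func_space_def vec_def dest: fun_cong[of _ _ j])
  have "e (digit q 1 0) = e (digit q 1 1)" using 0[of 0] 0[of 1] d by simp
  moreover have "digit q 1 0 = 1" "digit q 1 1 = 0" using q_ge_2 by (simp_all add: digit_def)
  ultimately show False using e_eq_iff[of 1 0] q_ge_2 by simp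
qed

text \<open>Beyond the first position, zero is a combination of the earlier vectors and so is
  excluded by \<open>chosen_new\<close>.\<close>

lemma chosen_nonzero: "k < length (chosen m) \<Longrightarrow> vec (chosen m ! k) \<noteq> \<zero>\<^bsub>Vd\<^esub>"
proof (cases "k = 0")
  case True
  assume "k < length (chosen m)"
  then have "chosen m \<noteq> []" by auto
  moreover from this have "m \<ge> 1" by (cases m) auto
  ultimately show ?thesis using True chosen_first[of m] vec_1_nonzero by (metis hd_conv_nth)
next
  case False
  assume k: "k < length (chosen m)"
  have "\<zero>\<^bsub>Vd\<^esub> \<in> V.combinations3 ((\<lambda>k. vec (chosen m ! k)) ` {..<k})"
    using False vec_carrier by (intro V.zero_in_combinations3) auto
  then show ?thesis using chosen_new[OF k] by metis
qed

lemma card_Vd: "card (carrier Vd) = q ^ d"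
  by (simp add: carrier_Vd card_PiE q)

text \<open>If fewer than \<open>n\<close> vectors were found, their combinations together with
  \<open>vec 0\<close> would exhaust the space, contradicting the count.\<close>

lemma length_chosen:
  assumes n: "n \<ge> 1" and big: "(q * n) ^ 3 \<le> q ^ d"
  shows "n \<le> length (chosen (q ^ d))"
proof (rule ccontr)
  define L where "L = chosen (q ^ d)"
  assume "\<not> n \<le> length (chosen (q ^ d))"
  then have "length L + 1 \<le> n" by (simp add: L_def)
  \<comment> \<open>Since \<open>vec 0\<close> is counted separately, one unit of slack is needed
    between the cubes; \<open>q \<ge> 2\<close> and one missing vector provide it.\<close>
  then have "q * length L + 2 \<le> q * n"
    using q_ge_2 mult_le_mono2[of "length L + 1" n q] by simp
  then have lt: "(q * length L) ^ 3 + 1 < (q * n) ^ 3"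
    using power_mono[of "q * length L + 2" "q * n" 3] by (simp add: power3_eq_cube algebra_simps)
  have "carrier Vd \<subseteq> insert (vec 0) (V.combinations3 (vec ` set L))"
  proof
    fix v assume "v \<in> carrier Vd"
    then obtain i where "i < q ^ d" "vec i = v" using vec_surj by blast
    then show "v \<in> insert (vec 0) (V.combinations3 (vec ` set L))"
      using vec_in_combinations3_chosen[of i "q ^ d"] by (cases "i = 0") (auto simp: L_def)
  qed
  moreover have fin: "finite (V.combinations3 (vec ` set L))"
    unfolding V.combinations3_def using finite_F by auto
  ultimately have "q ^ d \<le> card (insert (vec 0) (V.combinations3 (vec ` set L)))"
    using card_mono card_Vd by (metis finite_insert)
  also have "\<dots> \<le> Suc (card (V.combinations3 (vec ` set L)))" using fin by (simp add: card_insert_if)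
  also have "\<dots> \<le> Suc ((q * card (vec ` set L)) ^ 3)"
    using V.card_combinations3[of "vec ` set L"] finite_F by (simp add: q)
  also have "\<dots> \<le> Suc ((q * length L) ^ 3)"
  proof -
    have "card (vec ` set L) \<le> length L" by (rule order.trans[OF card_image_le card_length]) simp
    then show ?thesis by (simp add: power_mono)
  qed
  finally show False using lt big by simp
qed

end

text \<open>Table entries past \<open>q * q\<close> are 0, which is still a code, so the bounds hold
  at every index.\<close>

lemma coded_field_input_state:
  fixes F :: "('a, 'r) ring_scheme"
  assumes "field F" "finite (carrier F)" "q = card (carrier F)" "bij_betw e {..<q} (carrier F)" "d \<ge> 2"
  shows "coded_field F e q d (arrs (input_state F e n) 0) (arrs (input_state F e n) 1)"
proof -
  interpret field F by fact
  let ?code = "inv_into {..<q} e"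
  have img: "e ` {..<q} = carrier F" using assms(4) by (simp add: bij_betw_def)
  have code: "?code x < q" "e (?code x) = x" if "x \<in> carrier F" for x
    using inv_into_into[of x e "{..<q}"] f_inv_into_f[of x e "{..<q}"] that img by auto
  have e: "e a \<in> carrier F" if "a < q" for a using img that by auto
  have "card (carrier F) > 0" using assms(2) by (auto simp: card_gt_0_iff)
  then have q0: "q > 0" using assms(3) by simp
  have tab: "arrs (input_state F e n) 0 k = (if k < q * q then ?code (e (k div q) \<oplus>\<^bsub>F\<^esub> e (k mod q)) else 0)"
    "arrs (input_state F e n) 1 k = (if k < q * q then ?code (e (k div q) \<otimes>\<^bsub>F\<^esub> e (k mod q)) else 0)" for k
    using assms(3) by (simp_all add: input_state_def Let_def)
  have e2: "e (k div q) \<in> carrier F" "e (k mod q) \<in> carrier F" if "k < q * q" for k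
    using that q0 by (auto intro!: e simp: less_mult_imp_div_less)
  have idx: "a * q + b < q * q" if "a < q" "b < q" for a b
    using prod_add_less[OF that] .
  have less: "arrs (input_state F e n) 0 k < q" "arrs (input_state F e n) 1 k < q" for k
    unfolding tab using q0 by (simp_all add: code e2)
  have val: "e (arrs (input_state F e n) 0 (a * q + b)) = e a \<oplus>\<^bsub>F\<^esub> e b"
    "e (arrs (input_state F e n) 1 (a * q + b)) = e a \<otimes>\<^bsub>F\<^esub> e b" if "a < q" "b < q" for a b
    unfolding tab using that q0 idx[OF that] e by (simp_all add: code)
  show ?thesis
    by unfold_locales (rule assms less val; assumption)+
qed

section \<open>The complete program and its time polynomial\<close>

definition program :: com where
  "program = Seq prepare main_loop"

text \<open>Here \<open>m\<close> stands for \<open>n + q\<close>; \<open>m ^ 3 + 4\<close>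
  dominates \<open>d\<close>, and \<open>m ^ 4 * m ^ 3\<close> dominates the number
  \<open>q ^ d\<close> of candidates.\<close>

definition program_time :: "'b::comm_semiring_1 \<Rightarrow> 'b" where
  "program_time m = prepare_time m m (m ^ 3 + 4) + main_loop_time m m (m ^ 3 + 4) (m ^ 4 * m ^ 3)"

lemma program_time_mono:
  fixes n q d N m :: nat
  assumes "n \<le> m" "q \<le> m" "d \<le> m ^ 3 + 4" "N \<le> m ^ 4 * m ^ 3"
  shows "prepare_time n q d + main_loop_time n q d N \<le> program_time m"
  unfolding program_time_def prepare_time_def main_loop_time_def search_time_def
  by (intro add_mono mult_mono assms le_refl zero_le)

text \<open>Evaluation is a semiring homomorphism; applied to the identity polynomial
  \<open>[:0, 1:]\<close> this makes \<open>program_time\<close> an actual polynomial.\<close>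

lemma poly_program_time: "poly (program_time p) m = program_time (poly p m)"
  by (simp only: program_time_def prepare_time_def main_loop_time_def search_time_def
      poly_add poly_mult poly_power poly_numeral)

theorem theorem1:
  shows "\<exists>(c :: com) (p :: nat poly).
    \<forall>(F :: ('a, 'r) ring_scheme) (e :: nat \<Rightarrow> 'a) (n :: nat) (q :: nat) (d :: nat).
      field F \<and> finite (carrier F) \<and> q = card (carrier F) \<and>
      bij_betw e {..<q} (carrier F) \<and>
      n \<ge> 1 \<and> d = nat \<lceil>3 * ln (real n) / ln (real q) + 3\<rceil> \<longrightarrow>
      real n \<le> real q powr ((real d - 3) / 3) \<and>
      (\<exists>t s S.
         exec c (input_state F e n) t s \<and> t \<le> poly p (n + q) \<and>
         outputs F e n d s S \<and>
         four_term_independent F (coord_space F d) S \<and>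
         card S = n \<and>
         card (carrier (coord_space F d)) \<le> q ^ 4 * n ^ 3 \<and>
         linear_Sidon F (coord_space F d) S)"
proof (intro exI[of _ program] exI[of _ "program_time [:0, 1:]"] allI impI)
  fix F :: "('a, 'r) ring_scheme" and e :: "nat \<Rightarrow> 'a" and n q d :: nat
  assume asm: "field F \<and> finite (carrier F) \<and> q = card (carrier F) \<and>
      bij_betw e {..<q} (carrier F) \<and>
      n \<ge> 1 \<and> d = nat \<lceil>3 * ln (real n) / ln (real q) + 3\<rceil>"
  then have F: "field F" "finite (carrier F)" "q = card (carrier F)" "bij_betw e {..<q} (carrier F)"
    and n: "n \<ge> 1" and d_def: "d = nat \<lceil>3 * ln (real n) / ln (real q) + 3\<rceil>"
    by blast+
  interpret field F by (rule F(1))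
  have "card {\<zero>\<^bsub>F\<^esub>, \<one>\<^bsub>F\<^esub>} \<le> q" unfolding F(3) using F(2) by (intro card_mono) auto
  then have q2: "q \<ge> 2" by simp
  have d3: "d \<ge> 3" and d: "\<And>i. q ^ i < n ^ 3 \<longleftrightarrow> i < d - 3"
    using dimension_bounds[OF q2 n d_def] by blast+
  let ?s = "input_state F e n"
  interpret C: coded_field F e q d "arrs ?s 0" "arrs ?s 1"
    using d3 by (intro coded_field_input_state F) simp
  have n3: "n ^ 3 \<le> q ^ (d - 3)" using d[of "d - 3"] by simp
  have qd: "q ^ d = q ^ 3 * q ^ (d - 3)" using d3 by (simp flip: power_add)
  have big: "(q * n) ^ 3 \<le> q ^ d" using n3 qd by (simp add: power_mult_distrib)
  \<comment> \<open>Minimality of \<open>d - 3\<close> gives \<open>q ^ (d - 4) < n ^ 3\<close>,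
    except at \<open>d = 3\<close>, where there is no smaller exponent and \<open>n \<ge> 1\<close>
    suffices.\<close>
  have small: "q ^ d \<le> q ^ 4 * n ^ 3"
  proof (cases "d = 3")
    case True
    have "q ^ 3 * 1 \<le> q ^ 4 * n ^ 3" using q2 n by (intro mult_mono power_increasing) auto
    then show ?thesis using True by simp
  next
    case False
    then have "q ^ (d - 4) < n ^ 3" using d[of "d - 4"] d3 by simp
    moreover have "q ^ d = q ^ 4 * q ^ (d - 4)" using False d3 by (simp flip: power_add)
    ultimately show ?thesis by simp
  qed
  \<comment> \<open>A polynomial bound on \<open>d\<close> without logarithms:
    \<open>d - 4 < 2 ^ (d - 4) \<le> q ^ (d - 4) < n ^ 3\<close>.\<close>
  have d_le: "d \<le> n ^ 3 + 4"
  proof (cases "d \<le> 4")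
    case False
    then have "q ^ (d - 4) < n ^ 3" using d[of "d - 4"] d3 by simp
    moreover have "d - 4 < q ^ (d - 4)"
      using q2 by (intro less_le_trans[OF less_exp power_mono]) auto
    ultimately show ?thesis by simp
  qed simp
  have bound: "real n \<le> real q powr ((real d - 3) / 3)"
  proof -
    \<comment> \<open>Cubing both sides turns the exponent \<open>(d - 3) / 3\<close> into the
      natural number \<open>d - 3\<close>.\<close>
    have cube: "(real q powr x) ^ 3 = real q powr (3 * x)" for x
      using q2 by (simp add: powr_power)
    have third: "3 * ((real d - 3) / 3) = real d - 3" by simp
    have "real n ^ 3 \<le> real q ^ (d - 3)" using n3 by (metis of_nat_le_iff of_nat_power)
    also have "\<dots> = real q powr (real d - 3)" using q2 d3 by (simp add: powr_realpow[symmetric] of_nat_diff)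
    also have "\<dots> = (real q powr ((real d - 3) / 3)) ^ 3"
      by (simp only: cube third)
    finally show ?thesis by (rule power_mono_iff[THEN iffD1, rotated 3]) simp_all
  qed
  have "achieves program (prepare_time n q d + main_loop_time n q d (q ^ d))
     (\<lambda>s. \<exists>i. length (C.chosen i) = n \<and> holds q d (C.chosen i) s) ?s"
    unfolding program_def
  proof (rule achieves_Seq, rule achieves_mono[OF achieves_prepare le_refl])
    fix s assume "prepared n q d (arrs ?s 0) (arrs ?s 1) s"
    then show "achieves main_loop (main_loop_time n q d (q ^ d))
       (\<lambda>s. \<exists>i. length (C.chosen i) = n \<and> holds q d (C.chosen i) s) s"
      using C.length_chosen[OF n big] q2 C.T0_less C.T1_less by (intro achieves_main_loop) auto
  qed (use d d3 F(3) in \<open>simp_all add: input_state_def Let_def\<close>)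
  then obtain t s i where run: "exec program ?s t s"
    and t: "t \<le> prepare_time n q d + main_loop_time n q d (q ^ d)"
    and len: "length (C.chosen i) = n" and s: "holds q d (C.chosen i) s"
    unfolding achieves_def by auto
  let ?v = "\<lambda>k. C.vec (C.chosen i ! k)"
  define S where "S = ?v ` {..<n}"
  have "t \<le> poly (program_time [:0, 1:]) (n + q)"
  proof (rule order.trans[OF t], rule order.trans[OF program_time_mono])
    have "n ^ 3 \<le> (n + q) ^ 3" "q ^ 4 \<le> (n + q) ^ 4" by (simp_all add: power_mono)
    then show "d \<le> (n + q) ^ 3 + 4" "q ^ d \<le> (n + q) ^ 4 * (n + q) ^ 3"
      using d_le small mult_le_mono[of "q ^ 4" "(n + q) ^ 4" "n ^ 3" "(n + q) ^ 3"] by linarith+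
  qed (simp_all add: poly_program_time)
  moreover have row: "arrs s 2 (k * d + j) = digit q (C.chosen i ! k) j" if "k < n" "j < d" for k j
    using s that len by (simp add: holds_def)
  have "outputs F e n d s S"
    unfolding outputs_def
  proof (intro conjI allI impI)
    fix l assume l: "l < n * d"
    then have "l div d < n" "l mod d < d" using d3 by (auto simp: less_mult_imp_div_less)
    from row[OF this] show "arrs s 2 l < card (carrier F)"
      using C.digit_less F(3) by simp
  next
    show "S = (\<lambda>k. \<lambda>j\<in>{..<d}. e (arrs s 2 (k * d + j))) ` {..<n}"
      unfolding S_def by (intro image_cong refl) (auto simp: C.vec_def row fun_eq_iff restrict_def)
  qed
  moreover have indep: "four_term_independent F (coord_space F d) S"
    unfolding S_def by (rule C.V.four_term_independent_greedy(1))
      (simp_all only: C.vec_carrier C.chosen_nonzero C.chosen_new len not_False_eq_True)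
  moreover have inj: "inj_on ?v {..<n}"
    by (rule C.V.four_term_independent_greedy(2))
      (simp_all only: C.vec_carrier C.chosen_nonzero C.chosen_new len not_False_eq_True)
  moreover have "card S = n" unfolding S_def using inj by (simp add: card_image)
  moreover have "card (carrier (coord_space F d)) \<le> q ^ 4 * n ^ 3" using C.card_Vd small by simp
  moreover have "linear_Sidon F (coord_space F d) S"
    using C.V.four_term_independent_imp_linear_Sidon[OF indep] .
  ultimately show "real n \<le> real q powr ((real d - 3) / 3) \<and>
      (\<exists>t s S.
         exec program (input_state F e n) t s \<and> t \<le> poly (program_time [:0, 1:]) (n + q) \<and>
         outputs F e n d s S \<and>
         four_term_independent F (coord_space F d) S \<and>
         card S = n \<and>
         card (carrier (coord_space F d)) \<le> q ^ 4 * n ^ 3 \<and>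
         linear_Sidon F (coord_space F d) S)"
    using bound run by blast
qed

end
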